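(* There are abstract regular polytopes which have a pure realization of complex type with arbitrarily large essential Wythoff dimension. That is: for every $N\in\mathbb{N}$ there exist a finite string C-group $G=\langle s_0,\dots,s_{n-1}\rangle$ with vertex stabilizer $H=\langle s_1,\dots,s_{n-1}\rangle$ and $G$-set $\Omega=\{Hg\mid g\in G\}$ of right cosets, and a pure realization $A\colon\Omega\to S$ with $S$ a simple euclidean $G$-space spanned by $\{\omega A\mid\omega\in\Omega\}$, such that $\mathbb{D}=\operatorname{End}_{\mathbb{R}G}(S)\cong\mathbb{C}$ and the essential Wythoff dimension $\dim_{\mathbb{D}}\operatorname{Fix}_S(H)$ of $S$ is at least $N$.
   Context: A string C-group is a group $G=\langle s_0,s_1,\dots,s_{n-1}\rangle$ with distinguished generators that are involutions, such that $s_is_j=s_js_i$ whenever $|i-j|\ge 2$, and such that the intersection property $\langle s_i\mid i\in I\rangle\cap\langle s_j\mid j\in J\rangle=\langle s_k\mid k\in I\cap J\rangle$ holds for all $I,J\subseteq\{0,1,\dots,n-1\}$. Abstract regular polytopes are, equivalently, encoded by string C-groups: $G$ is the automorphism group of the polytope, $H=\langle s_1,\dots,s_{n-1}\rangle$ is the stabilizer of a vertex, and the vertex set is the set of right cosets of $H$ in $G$. A euclidean $G$-space is a euclidean vector space on which $G$ acts from the right by orthogonal transformations. A realization of a transitive $G$-set $\Omega$ is a map $A\colon\Omega\to V$ into a euclidean $G$-space $V$ with $(\omega g)A=(\omega A)g$ for all $\omega\in\Omega$, $g\in G$. It is pure if the linear span of $\{\omega A\mid\omega\in\Omega\}$ is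 a simple $\mathbb{R}G$-module. A simple $\mathbb{R}G$-module $S$ is of complex type if $\operatorname{End}_{\mathbb{R}G}(S)\cong\mathbb{C}$. $\operatorname{Fix}_S(H)$ denotes the space of $H$-fixed vectors in $S$ (the Wythoff space); the essential Wythoff dimension is its dimension over $\operatorname{End}_{\mathbb{R}G}(S)$. *)

theory Defs
  imports
    "HOL-Algebra.QuotRing"
    "HOL-Algebra.Generated_Groups"
    "HOL-Library.Poly_Mapping"
    "HOL-Analysis.Inner_Product"
    "Jordan_Normal_Form.Missing_VectorSpace"
begin

section \<open>An ambient inner product space\<close>

text \<open>
  Finitely supported functions carry the standard inner product.  The space
  \<open>nat \<Rightarrow>\<^sub>0 real\<close> contains an isometric copy of every euclidean vector space (as a
  finite-dimensional subspace), so that an existential quantifier over finite-dimensional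
  subspaces of this type ranges over all euclidean vector spaces up to isometry.
  Similarly, \<open>nat monoid\<close> contains a copy of every finite group.
\<close>

instantiation poly_mapping :: (type, real_inner) real_inner
begin

lift_definition scaleR_poly_mapping :: "real \<Rightarrow> ('a \<Rightarrow>\<^sub>0 'b) \<Rightarrow> 'a \<Rightarrow>\<^sub>0 'b"
  is "\<lambda>r f k. r *\<^sub>R f k"
  by (rule finite_subset) auto

definition inner_poly_mapping :: "('a \<Rightarrow>\<^sub>0 'b) \<Rightarrow> ('a \<Rightarrow>\<^sub>0 'b) \<Rightarrow> real"
  where "inner_poly_mapping f g = 
    (\<Sum>k\<in>Poly_Mapping.keys f. inner (Poly_Mapping.lookup f k) (Poly_Mapping.lookup g k))"

definition norm_poly_mapping :: "('a \<Rightarrow>\<^sub>0 'b) \<Rightarrow> real"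
  where "norm_poly_mapping f = sqrt (inner f f)"

definition sgn_poly_mapping :: "('a \<Rightarrow>\<^sub>0 'b) \<Rightarrow> 'a \<Rightarrow>\<^sub>0 'b"
  where "sgn_poly_mapping f = inverse (norm f) *\<^sub>R f"

definition dist_poly_mapping :: "('a \<Rightarrow>\<^sub>0 'b) \<Rightarrow> ('a \<Rightarrow>\<^sub>0 'b) \<Rightarrow> real"
  where "dist_poly_mapping f g = norm (f - g)"

definition uniformity_poly_mapping :: "(('a \<Rightarrow>\<^sub>0 'b) \<times> ('a \<Rightarrow>\<^sub>0 'b)) filter"
  where "uniformity_poly_mapping = (INF e\<in>{0 <..}. principal {(f, g). dist f g < e})"

definition open_poly_mapping :: "('a \<Rightarrow>\<^sub>0 'b) set \<Rightarrow> bool"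
  where "open_poly_mapping U \<longleftrightarrow>
    (\<forall>f\<in>U. eventually (\<lambda>(f', g). f' = f \<longrightarrow> g \<in> U) uniformity)"

lemma lookup_scaleR [simp]: "Poly_Mapping.lookup (r *\<^sub>R f) k = r *\<^sub>R Poly_Mapping.lookup f k"
  for f :: "'a \<Rightarrow>\<^sub>0 'b"
  by transfer simp

lemma inner_poly_mapping_superset:
  fixes f g :: "'a \<Rightarrow>\<^sub>0 'b"
  assumes "finite K" "Poly_Mapping.keys f \<subseteq> K"
  shows "inner f g = (\<Sum>k\<in>K. inner (Poly_Mapping.lookup f k) (Poly_Mapping.lookup g k))"
  unfolding inner_poly_mapping_def
  by (rule sum.mono_neutral_left) (use assms in \<open>auto simp: in_keys_iff\<close>)

instance
proof
  fix f g h :: "'a \<Rightarrow>\<^sub>0 'b" and r s :: real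
  show "r *\<^sub>R (f + g) = r *\<^sub>R f + r *\<^sub>R g"
    by (rule poly_mapping_eqI) (simp add: lookup_add scaleR_add_right)
  show "(r + s) *\<^sub>R f = r *\<^sub>R f + s *\<^sub>R f"
    by (rule poly_mapping_eqI) (simp add: lookup_add scaleR_add_left)
  show "r *\<^sub>R s *\<^sub>R f = (r * s) *\<^sub>R f"
    by (rule poly_mapping_eqI) simp
  show "1 *\<^sub>R f = f"
    by (rule poly_mapping_eqI) simp
  let ?K = "Poly_Mapping.keys f \<union> Poly_Mapping.keys g"
  have K: "finite ?K" "Poly_Mapping.keys f \<subseteq> ?K" "Poly_Mapping.keys g \<subseteq> ?K"
    "Poly_Mapping.keys (f + g) \<subseteq> ?K" "Poly_Mapping.keys (r *\<^sub>R f) \<subseteq> ?K"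
    by (auto simp: in_keys_iff lookup_add)
  show "inner f g = inner g f"
    by (simp add: inner_poly_mapping_superset[OF K(1)] K inner_commute)
  show "inner (f + g) h = inner f h + inner g h"
    unfolding inner_poly_mapping_superset[OF K(1,4)] inner_poly_mapping_superset[OF K(1,2)]
      inner_poly_mapping_superset[OF K(1,3)]
    by (simp add: lookup_add inner_add_left sum.distrib)
  show "inner (r *\<^sub>R f) g = r * inner f g"
    unfolding inner_poly_mapping_superset[OF K(1,5)] inner_poly_mapping_superset[OF K(1,2)]
    by (simp add: sum_distrib_left)
  show "0 \<le> inner f f"
    by (simp add: inner_poly_mapping_def sum_nonneg)
  show "inner f f = 0 \<longleftrightarrow> f = 0"
    by (simp add: inner_poly_mapping_def sum_nonneg_eq_0_iff in_keys_iff)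
       (metis in_keys_iff keys_eq_empty equals0I lookup_zero)
qed (simp_all add: norm_poly_mapping_def sgn_poly_mapping_def dist_poly_mapping_def
      uniformity_poly_mapping_def open_poly_mapping_def)

end

section \<open>String C-groups\<close>

locale string_C_group = group G for G (structure) +
  fixes n :: nat and s :: "nat \<Rightarrow> 'a"
  assumes gen_closed: "i < n \<Longrightarrow> s i \<in> carrier G"
    and gen_nontrivial: "i < n \<Longrightarrow> s i \<noteq> \<one>"
    and gen_square: "i < n \<Longrightarrow> s i \<otimes> s i = \<one>"
    and gen_generate: "generate G (s ` {..<n}) = carrier G"
    and string: "i + 2 \<le> j \<Longrightarrow> j < n \<Longrightarrow> s i \<otimes> s j = s j \<otimes> s i"
    and intersection_property: "I \<subseteq> {..<n} \<Longrightarrow> J \<subseteq> {..<n} \<Longrightarrow>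
      generate G (s ` I) \<inter> generate G (s ` J) = generate G (s ` (I \<inter> J))"

definition vertex_stabilizer :: "('a, 'm) monoid_scheme \<Rightarrow> nat \<Rightarrow> (nat \<Rightarrow> 'a) \<Rightarrow> 'a set"
  where "vertex_stabilizer G n s = generate G (s ` {1..<n})"

section \<open>\<open>G\<close>-sets, \<open>\<real>G\<close>-modules and realizations\<close>

locale right_action = group G for G (structure) +
  fixes X :: "'x set" and act :: "'x \<Rightarrow> 'a \<Rightarrow> 'x"
  assumes act_closed: "x \<in> X \<Longrightarrow> g \<in> carrier G \<Longrightarrow> act x g \<in> X"
    and act_one: "x \<in> X \<Longrightarrow> act x \<one> = x"
    and act_mult: "x \<in> X \<Longrightarrow> g \<in> carrier G \<Longrightarrow> h \<in> carrier G \<Longrightarrow>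
      act x (g \<otimes> h) = act (act x g) h"

locale transitive_G_set = right_action +
  assumes nonempty: "X \<noteq> {}"
    and transitive: "x \<in> X \<Longrightarrow> y \<in> X \<Longrightarrow> \<exists>g\<in>carrier G. act x g = y"

text \<open>
  The constants of \<^theory>\<open>HOL.Real_Vector_Spaces\<close> are referred to with the prefix
  \<open>real_vector\<close>, because the vector space theory over \<open>HOL-Algebra\<close> reuses the short names.
\<close>

locale RG_module = right_action G V act
  for G (structure) and V :: "'v::real_vector set" and act +
  assumes subspace: "real_vector.subspace V"
    and act_add: "x \<in> V \<Longrightarrow> y \<in> V \<Longrightarrow> g \<in> carrier G \<Longrightarrow> act (x + y) g = act x g + act y g"
    and act_scaleR: "x \<in> V \<Longrightarrow> g \<in> carrier G \<Longrightarrow> act (r *\<^sub>R x) g = r *\<^sub>R act x g"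

locale simple_RG_module = RG_module +
  assumes nonzero: "V \<noteq> {0}"
    and simple: "real_vector.subspace U \<Longrightarrow> U \<subseteq> V \<Longrightarrow>
      (\<forall>u\<in>U. \<forall>g\<in>carrier G. act u g \<in> U) \<Longrightarrow> U = {0} \<or> U = V"

locale euclidean_G_space = RG_module G V act
  for G (structure) and V :: "'v::real_inner set" and act +
  assumes finite_dimensional: "\<exists>B. finite B \<and> real_vector.span B = V"
    and orthogonal: "x \<in> V \<Longrightarrow> y \<in> V \<Longrightarrow> g \<in> carrier G \<Longrightarrow>
      inner (act x g) (act y g) = inner x y"

locale realization =
  G_set: transitive_G_set G \<Omega> act\<Omega> + G_space: euclidean_G_space G V act
  for G (structure) and \<Omega> :: "'x set" and act\<Omega>
    and V :: "'v::real_inner set" and act +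
  fixes A :: "'x \<Rightarrow> 'v"
  assumes map_closed: "\<omega> \<in> \<Omega> \<Longrightarrow> A \<omega> \<in> V"
    and equivariant: "\<omega> \<in> \<Omega> \<Longrightarrow> g \<in> carrier G \<Longrightarrow> A (act\<Omega> \<omega> g) = act (A \<omega>) g"

locale pure_realization = realization +
  assumes pure: "simple_RG_module G (real_vector.span (A ` \<Omega>)) act"

section \<open>Endomorphism ring and essential Wythoff dimension\<close>

text \<open>
  Endomorphisms are represented by functions that are \<open>undefined\<close> outside of the module
  (\<^const>\<open>extensional\<close>), so that equality of ring elements is equality of maps on the module.
\<close>

definition RG_End ::
    "('a, 'm) monoid_scheme \<Rightarrow> 'v::real_vector set \<Rightarrow> ('v \<Rightarrow> 'a \<Rightarrow> 'v) \<Rightarrow> ('v \<Rightarrow> 'v) ring"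
  where "RG_End G V act = \<lparr>
    carrier = {f \<in> V \<rightarrow>\<^sub>E V.
      (\<forall>x\<in>V. \<forall>y\<in>V. f (x + y) = f x + f y) \<and>
      (\<forall>r. \<forall>x\<in>V. f (r *\<^sub>R x) = r *\<^sub>R f x) \<and>
      (\<forall>x\<in>V. \<forall>g\<in>carrier G. f (act x g) = act (f x) g)},
    mult = (\<lambda>f g. \<lambda>x\<in>V. f (g x)),
    one = (\<lambda>x\<in>V. x),
    zero = (\<lambda>x\<in>V. 0),
    add = (\<lambda>f g. \<lambda>x\<in>V. f x + g x)\<rparr>"

definition complex_ring :: "complex ring"
  where "complex_ring = \<lparr>carrier = UNIV, mult = (*), one = 1, zero = 0, add = (+)\<rparr>"

text \<open>The isomorphism with the complex numbers is one of \<open>\<real>\<close>-algebras.\<close>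

definition complex_type ::
    "('a, 'm) monoid_scheme \<Rightarrow> 'v::real_vector set \<Rightarrow> ('v \<Rightarrow> 'a \<Rightarrow> 'v) \<Rightarrow> bool"
  where "complex_type G V act \<longleftrightarrow>
    (\<exists>\<phi>\<in>ring_iso (RG_End G V act) complex_ring. \<forall>r. \<phi> (\<lambda>x\<in>V. r *\<^sub>R x) = of_real r)"

definition Fix :: "('v \<Rightarrow> 'a \<Rightarrow> 'v) \<Rightarrow> 'v set \<Rightarrow> 'a set \<Rightarrow> 'v set"
  where "Fix act V H = {v \<in> V. \<forall>h\<in>H. act v h = v}"

text \<open>
  The Wythoff space as a module over the endomorphism ring, which acts by evaluation.
  Modules in \<open>HOL-Algebra\<close> are ring records; their fields \<open>mult\<close> and \<open>one\<close> are irrelevant.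
\<close>

definition wythoff_module ::
    "('v \<Rightarrow> 'a \<Rightarrow> 'v) \<Rightarrow> 'v::real_vector set \<Rightarrow> 'a set \<Rightarrow> ('v \<Rightarrow> 'v, 'v) module"
  where "wythoff_module act V H = \<lparr>
    carrier = Fix act V H,
    mult = undefined,
    one = undefined,
    zero = 0,
    add = (+),
    smult = (\<lambda>f x. f x)\<rparr>"

text \<open>
  The constant \<^const>\<open>vectorspace.dim\<close> is meaningful over a field; by
  \<open>complex_type_vectorspace\<close> below this covers the modules of complex type.
\<close>

definition essential_wythoff_dim ::
    "('a, 'm) monoid_scheme \<Rightarrow> 'a set \<Rightarrow> 'v::real_vector set \<Rightarrow> ('v \<Rightarrow> 'a \<Rightarrow> 'v) \<Rightarrow> nat"
  where "essential_wythoff_dim G H V act =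
    vectorspace.dim (RG_End G V act) (wythoff_module act V H)"

context RG_module
begin

lemma zero_mem: "0 \<in> V" and add_mem: "x \<in> V \<Longrightarrow> y \<in> V \<Longrightarrow> x + y \<in> V"
  and scaleR_mem: "x \<in> V \<Longrightarrow> r *\<^sub>R x \<in> V"
  using subspace
  by (auto intro: real_vector.subspace_0 real_vector.subspace_add real_vector.subspace_scale)

lemma act_zero: "g \<in> carrier G \<Longrightarrow> act 0 g = 0"
  using act_scaleR[of 0 g 0] zero_mem by simp

lemma RG_End_simps:
  "\<one>\<^bsub>RG_End G V act\<^esub> = (\<lambda>x\<in>V. x)"
  "\<zero>\<^bsub>RG_End G V act\<^esub> = (\<lambda>x\<in>V. 0)"
  "f \<otimes>\<^bsub>RG_End G V act\<^esub> f' = (\<lambda>x\<in>V. f (f' x))"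
  "f \<oplus>\<^bsub>RG_End G V act\<^esub> f' = (\<lambda>x\<in>V. f x + f' x)"
  by (simp_all add: RG_End_def)

lemma RG_End_memI:
  assumes "\<And>x. x \<in> V \<Longrightarrow> f x \<in> V" "f \<in> extensional V"
    and "\<And>x y. x \<in> V \<Longrightarrow> y \<in> V \<Longrightarrow> f (x + y) = f x + f y"
    and "\<And>r x. x \<in> V \<Longrightarrow> f (r *\<^sub>R x) = r *\<^sub>R f x"
    and "\<And>x g. x \<in> V \<Longrightarrow> g \<in> carrier G \<Longrightarrow> f (act x g) = act (f x) g"
  shows "f \<in> carrier (RG_End G V act)"
  using assms by (auto simp: RG_End_def PiE_iff)

lemma RG_End_memD:
  assumes "f \<in> carrier (RG_End G V act)"
  shows "x \<in> V \<Longrightarrow> f x \<in> V" "f \<in> extensional V"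
    and "x \<in> V \<Longrightarrow> y \<in> V \<Longrightarrow> f (x + y) = f x + f y"
    and "x \<in> V \<Longrightarrow> f (r *\<^sub>R x) = r *\<^sub>R f x"
    and "x \<in> V \<Longrightarrow> g \<in> carrier G \<Longrightarrow> f (act x g) = act (f x) g"
  using assms by (auto simp: RG_End_def PiE_iff)

lemma RG_End_eqI:
  assumes "f \<in> carrier (RG_End G V act)" "f' \<in> carrier (RG_End G V act)"
    and "\<And>x. x \<in> V \<Longrightarrow> f x = f' x"
  shows "f = f'"
  using assms by (meson RG_End_memD(2) extensionalityI)

lemma RG_End_closed:
  shows "(\<lambda>x\<in>V. x) \<in> carrier (RG_End G V act)"
    and "(\<lambda>x\<in>V. 0) \<in> carrier (RG_End G V act)"
    and "f \<in> carrier (RG_End G V act) \<Longrightarrow> f' \<in> carrier (RG_End G V act) \<Longrightarrow>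
      (\<lambda>x\<in>V. f (f' x)) \<in> carrier (RG_End G V act)"
    and "f \<in> carrier (RG_End G V act) \<Longrightarrow> f' \<in> carrier (RG_End G V act) \<Longrightarrow>
      (\<lambda>x\<in>V. f x + f' x) \<in> carrier (RG_End G V act)"
    and "f \<in> carrier (RG_End G V act) \<Longrightarrow>
      (\<lambda>x\<in>V. r *\<^sub>R f x) \<in> carrier (RG_End G V act)"
  by (rule RG_End_memI; simp add: RG_End_memD zero_mem add_mem scaleR_mem act_closed
      act_zero act_add act_scaleR algebra_simps)+

lemma ring_RG_End: "ring (RG_End G V act)"
proof (rule ringI)
  let ?E = "RG_End G V act"
  show "abelian_group ?E"
  proof (rule abelian_groupI)
    fix f assume f: "f \<in> carrier ?E"
    show "\<zero>\<^bsub>?E\<^esub> \<oplus>\<^bsub>?E\<^esub> f = f"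
      using RG_End_memD(2)[OF f]
      by (simp add: RG_End_simps extensional_restrict cong: restrict_cong)
    have "(\<lambda>x\<in>V. (-1) *\<^sub>R f x) \<oplus>\<^bsub>?E\<^esub> f = \<zero>\<^bsub>?E\<^esub>"
      by (auto simp: RG_End_simps restrict_def)
    with RG_End_closed(5)[OF f] show "\<exists>f'\<in>carrier ?E. f' \<oplus>\<^bsub>?E\<^esub> f = \<zero>\<^bsub>?E\<^esub>"
      by blast
  qed (simp_all add: RG_End_simps RG_End_closed ac_simps cong: restrict_cong)
  show "monoid ?E"
    by (rule monoidI)
      (simp_all add: RG_End_simps RG_End_closed RG_End_memD(1,2) extensional_restrict
        cong: restrict_cong)
qed (simp_all add: RG_End_simps RG_End_memD(1,3) cong: restrict_cong)

lemma complex_type_field: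
  assumes "complex_type G V act"
  shows "field (RG_End G V act)"
proof -
  let ?E = "RG_End G V act"
  interpret E: ring ?E by (rule ring_RG_End)
  obtain \<phi> where \<phi>: "\<phi> \<in> ring_iso ?E complex_ring"
    using assms by (auto simp: complex_type_def)
  have inj: "inj_on \<phi> (carrier ?E)" and surj: "\<phi> ` carrier ?E = UNIV"
    and mult: "\<And>f f'. f \<in> carrier ?E \<Longrightarrow> f' \<in> carrier ?E \<Longrightarrow> \<phi> (f \<otimes>\<^bsub>?E\<^esub> f') = \<phi> f * \<phi> f'"
    and add: "\<And>f f'. f \<in> carrier ?E \<Longrightarrow> f' \<in> carrier ?E \<Longrightarrow> \<phi> (f \<oplus>\<^bsub>?E\<^esub> f') = \<phi> f + \<phi> f'"
    and one: "\<phi> \<one>\<^bsub>?E\<^esub> = 1"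
    using \<phi> by (auto simp: ring_iso_def ring_hom_def bij_betw_def complex_ring_def)
  have zero: "\<phi> \<zero>\<^bsub>?E\<^esub> = 0"
    using add[of "\<zero>\<^bsub>?E\<^esub>" "\<zero>\<^bsub>?E\<^esub>"] by simp
  have comm: "f \<otimes>\<^bsub>?E\<^esub> f' = f' \<otimes>\<^bsub>?E\<^esub> f" if "f \<in> carrier ?E" "f' \<in> carrier ?E" for f f'
    by (rule inj_onD[OF inj]) (use that in \<open>simp_all add: mult\<close>)
  interpret E: cring ?E
    by (intro cring.intro comm_monoid.intro comm_monoid_axioms.intro ring_RG_End comm
        E.monoid_axioms)
  show ?thesis
  proof (rule E.cring_fieldI2)
    show "\<zero>\<^bsub>?E\<^esub> \<noteq> \<one>\<^bsub>?E\<^esub>"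
      using zero one by auto
    fix f assume f: "f \<in> carrier ?E" "f \<noteq> \<zero>\<^bsub>?E\<^esub>"
    then have "\<phi> f \<noteq> 0"
      using zero inj by (metis E.zero_closed inj_onD)
    obtain f' where f': "f' \<in> carrier ?E" "\<phi> f' = inverse (\<phi> f)"
      using surj by (metis UNIV_I imageE)
    have "f \<otimes>\<^bsub>?E\<^esub> f' = \<one>\<^bsub>?E\<^esub>"
      by (rule inj_onD[OF inj]) (use f f' \<open>\<phi> f \<noteq> 0\<close> in \<open>simp_all add: mult one\<close>)
    with f' show "\<exists>f'\<in>carrier ?E. f \<otimes>\<^bsub>?E\<^esub> f' = \<one>\<^bsub>?E\<^esub>" by blast
  qed
qed

lemma complex_type_vectorspace:
  assumes "complex_type G V act" and H: "H \<subseteq> carrier G"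
  shows "vectorspace (RG_End G V act) (wythoff_module act V H)"
proof -
  let ?W = "wythoff_module act V H"
  interpret E: field "RG_End G V act" by (rule complex_type_field[OF assms(1)])
  have "abelian_group ?W"
  proof (rule abelian_groupI)
    fix x assume x: "x \<in> carrier ?W"
    then have "- x \<in> carrier ?W"
      using H scaleR_mem[of x "-1"] act_scaleR[of x _ "-1"]
      by (auto simp: wythoff_module_def Fix_def subset_iff)
    then show "\<exists>y\<in>carrier ?W. y \<oplus>\<^bsub>?W\<^esub> x = \<zero>\<^bsub>?W\<^esub>"
      by (intro bexI[of _ "- x"]) (auto simp: wythoff_module_def)
  qed (use H in \<open>auto simp: wythoff_module_def Fix_def zero_mem add_mem act_add act_zero
      subset_iff algebra_simps\<close>)
  moreover have "f \<odot>\<^bsub>?W\<^esub> x \<in> carrier ?W"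
    if "f \<in> carrier (RG_End G V act)" "x \<in> carrier ?W" for f x
  proof -
    have x: "x \<in> V" "\<And>h. h \<in> H \<Longrightarrow> act x h = x"
      using that(2) by (auto simp: wythoff_module_def Fix_def)
    have "act (f x) h = f x" if "h \<in> H" for h
      using RG_End_memD(5)[OF \<open>f \<in> _\<close> x(1), of h] x(2)[OF that] H that by auto
    then show ?thesis
      using x RG_End_memD(1)[OF that(1)] by (simp add: wythoff_module_def Fix_def)
  qed
  ultimately have "module (RG_End G V act) ?W"
    by (intro moduleI E.cring_axioms)
      (auto simp: wythoff_module_def Fix_def RG_End_simps RG_End_memD)
  then show ?thesis
    by (simp add: vectorspace_def E.field_axioms)
qed

end

end

theory Submission
  imports Defs "HOL-Combinatorics.Permutations" "HOL-Library.Nat_Bijection"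
begin

text \<open>
  The vertex stabilizer stays the dihedral group of the hexagon, of order 12, while the dimension
  of the module grows.  Consider three monomial involutions of a complex space of dimension
  \<open>2 m\<close> with basis \<open>x\<^sub>0, x\<^sub>1, \<dots>\<close>: two of them, \<open>a\<close> and \<open>b\<close>, move the basis vectors along the edges
  of a cycle, alternately, in such a way that going once around the cycle multiplies a vector by
  the imaginary unit; the third, \<open>c\<close>, is the reflection that negates \<open>x\<^sub>0\<close>.  The module \<open>S\<close> is
  the sum of six copies of this space, indexed by the vertices of a hexagon.  The generator \<open>s 0\<close>
  acts on the six copies by \<open>c, a, 1, b, 1, a\<close>, and \<open>s 1\<close>, \<open>s 2\<close> permute the copies as
  generating reflections of the hexagon.  This sequence is invariant under the reflection \<open>s 2\<close>,
  so \<open>s 0\<close> and \<open>s 2\<close> commute.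

  The group that they generate is a string C-group because it maps onto the dihedral group
  \<open>H = \<langle>s 1, s 2\<rangle>\<close> by its action on the set of copies: this map is trivial on \<open>s 0\<close> and faithful
  on \<open>H\<close>, which is enough for the intersection property in rank 3
  (\<open>string_C_group_rank3I\<close>).

  Commutators of \<open>s 0\<close> with its conjugates are diagonal sign matrices, and they separate the lines
  spanned by the basis vectors (\<open>words_separating\<close>).  An endomorphism therefore preserves every
  line; it is complex linear, since going around the cycle acts as multiplication by \<open>i\<close>; and it
  is the same scalar on every line by transitivity (\<open>words_transitive\<close>).  Hence
  the endomorphism ring is \<open>\<complex>\<close>, and the same sign matrices show that \<open>S\<close> is simple
  (\<open>complex_type_V\<close>, \<open>simple_V\<close>).

  Finally \<open>H\<close> only permutes the copies, so its fixed space is the diagonal, of complex dimension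
  \<open>2 m\<close> (\<open>card_le_essential_wythoff_dim\<close> is the lower bound), and any nonzero diagonal vector
  gives a pure realization on the cosets of \<open>H\<close> (\<open>pure_realization_on_cosets\<close>).
\<close>

section \<open>Groups generated by three involutions\<close>

text \<open>
  Involutions are their own inverses, so every element of the subgroup that they generate is a
  product of generators, and it suffices to follow multiplication by a generator on the right.
\<close>

lemma (in group) generate_involutions_induct [consumes 1, case_names carrier involution one mult]:
  assumes g: "g \<in> generate G S"
    and S: "S \<subseteq> carrier G"
    and invol: "\<And>t. t \<in> S \<Longrightarrow> t \<otimes> t = \<one>"
    and one: "P \<one>"
    and step: "\<And>g t. g \<in> generate G S \<Longrightarrow> P g \<Longrightarrow> t \<in> S \<Longrightarrow> P (g \<otimes> t)"
  shows "P g"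
proof -
  have "\<forall>x\<in>generate G S. P x \<longrightarrow> P (x \<otimes> g)"
    using g
  proof (induction rule: generate.induct)
    case one
    show ?case
      using generate_in_carrier[OF S] by simp
  next
    case (incl h)
    then show ?case
      using step by blast
  next
    case (inv h)
    then have "inv h = h"
      using S invol by (metis inv_equality subsetD)
    with inv show ?case
      using step by simp
  next
    case (eng h k)
    then have "x \<otimes> (h \<otimes> k) = x \<otimes> h \<otimes> k" if "x \<in> generate G S" for x
      using generate_in_carrier[OF S] that by (simp add: m_assoc)
    with eng show ?case
      by (simp add: generate.eng)
  qed
  then have "P (\<one> \<otimes> g)"
    using one generate.one by blast
  then show ?thesis
    using generate_in_carrier[OF S g] by simp
qed

lemma (in group) generate_involution:
  assumes "t \<in> carrier G" "t \<otimes> t = \<one>"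
  shows "generate G {t} = {\<one>, t}"
proof
  show "generate G {t} \<subseteq> {\<one>, t}"
  proof
    fix g assume "g \<in> generate G {t}"
    then show "g \<in> {\<one>, t}"
      by (induction rule: generate_involutions_induct) (use assms in auto)
  qed
qed (auto intro: generate.one generate.incl)

lemma (in group) generate_commuting_involutions:
  assumes "t \<in> carrier G" "t \<otimes> t = \<one>" "u \<in> carrier G" "u \<otimes> u = \<one>" "t \<otimes> u = u \<otimes> t"
  shows "generate G {t, u} \<subseteq> {\<one>, t, u, t \<otimes> u}"
proof
  fix g assume "g \<in> generate G {t, u}"
  then show "g \<in> {\<one>, t, u, t \<otimes> u}"
  proof (induction rule: generate_involutions_induct)
    case (mult g w)
    have "t \<otimes> u \<otimes> t = u" "t \<otimes> u \<otimes> u = t"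
      using assms by (metis m_assoc r_one l_one)+
    with mult assms show ?case by auto
  qed (use assms in auto)
qed

text \<open>
  The intersection property is inherited along a map \<open>\<rho>\<close> that forgets \<open>s 0\<close> and is faithful on
  the vertex stabilizer \<open>\<langle>s 1, s 2\<rangle>\<close>.  An element of \<open>\<langle>s i | i \<in> I\<rangle>\<close> has the same image as an
  element of \<open>\<langle>s i | i \<in> I - {0}\<rangle>\<close>; if it also lies in the vertex stabilizer, the two agree.
  This settles every intersection with a subgroup of the vertex stabilizer.  Of the remaining
  ones, only \<open>\<langle>s 0, s 1\<rangle> \<inter> \<langle>s 0, s 2\<rangle>\<close> does not come from an inclusion, and there the second
  subgroup has only the four elements \<open>1, s 0, s 2, s 0 s 2\<close>.
\<close>

lemma (in group) string_C_group_rank3I: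
  fixes s :: "nat \<Rightarrow> 'a" and \<rho> :: "'a \<Rightarrow> 'q"
  assumes closed: "\<And>i. i < 3 \<Longrightarrow> s i \<in> carrier G"
    and nontrivial: "\<And>i. i < 3 \<Longrightarrow> s i \<noteq> \<one>"
    and square: "\<And>i. i < 3 \<Longrightarrow> s i \<otimes> s i = \<one>"
    and generate: "generate G (s ` {..<3}) = carrier G"
    and comm: "s 0 \<otimes> s 2 = s 2 \<otimes> s 0"
    and distinct: "s 1 \<noteq> s 2"
    and \<rho>_mult: "\<And>x y. x \<in> carrier G \<Longrightarrow> y \<in> carrier G \<Longrightarrow> \<rho> (x \<otimes> y) = comb (\<rho> x) (\<rho> y)"
    and \<rho>_0: "\<rho> (s 0) = \<rho> \<one>"
    and \<rho>_inj: "inj_on \<rho> (generate G (s ` {1, 2}))"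
  shows "string_C_group G 3 s"
proof -
  let ?E = "\<lambda>I. generate G (s ` I)"
  have sub: "s ` I \<subseteq> carrier G" if "I \<subseteq> {..<3}" for I
    using that closed by auto
  have mono: "?E I \<subseteq> ?E J" if "I \<subseteq> J" for I J
    using that by (intro mono_generate) auto
  have single: "?E {i} = {\<one>, s i}" if "i < 3" for i
    using generate_involution[of "s i"] that closed square by simp
  have forget: "\<exists>y\<in>?E (I - {0}). \<rho> y = \<rho> x" if x: "x \<in> ?E I" and I: "I \<subseteq> {..<3}" for x I
    using x
  proof (induction rule: generate_involutions_induct)
    case (mult g t)
    then obtain y i where y: "y \<in> ?E (I - {0})" "\<rho> y = \<rho> g" and i: "i \<in> I" "t = s i"
      by auto
    have i3: "i < 3"
      using i I by auto
    have yg: "y \<in> carrier G" "g \<in> carrier G"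
      using generate_in_carrier[OF sub] y(1) mult(1) I by blast+
    show ?case
    proof (cases "i = 0")
      case True
      have "\<rho> (g \<otimes> t) = \<rho> (g \<otimes> \<one>)"
        using True i i3 yg closed by (simp only: \<rho>_mult \<rho>_0 one_closed)
      with y yg show ?thesis by auto
    next
      case False
      have "\<rho> (g \<otimes> t) = \<rho> (y \<otimes> s i)"
        using i i3 yg closed y by (simp add: \<rho>_mult)
      moreover have "y \<otimes> s i \<in> ?E (I - {0})"
        using False i by (intro generate.eng[OF y(1) generate.incl]) auto
      ultimately show ?thesis by metis
    qed
  qed (use sub[OF I] I square in \<open>auto intro: generate.one\<close>)
  have part: "?E I \<inter> ?E J \<subseteq> ?E (I \<inter> J)" if I: "I \<subseteq> {..<3}" and J: "J \<subseteq> {..<3}" "0 \<notin> J" for I J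
  proof
    fix x assume x: "x \<in> ?E I \<inter> ?E J"
    let ?I = "I - {0}"
    have I12: "?I \<subseteq> {1, 2}" and J12: "J \<subseteq> {1, 2}"
      using I J by (auto simp: subset_iff less_Suc_eq numeral_3_eq_3)
    obtain y where y: "y \<in> ?E ?I" "\<rho> y = \<rho> x"
      using forget x I by blast
    have "y = x"
      using y x mono[OF I12] mono[OF J12] \<rho>_inj by (auto dest: inj_onD)
    with y have x': "x \<in> ?E ?I" by simp
    have "?I \<subseteq> J \<or> J \<subseteq> ?I \<or> (?I = {1} \<and> J = {2}) \<or> (?I = {2} \<and> J = {1})"
    proof -
      have "?I \<in> Pow {1, 2}" "J \<in> Pow {1, 2}"
        using I12 J12 by blast+
      then show ?thesis
        by (simp only: Pow_insert Pow_empty) auto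
    qed
    then consider "?I \<subseteq> J" | "J \<subseteq> ?I" | "?I = {1}" "J = {2}" | "?I = {2}" "J = {1}"
      by blast
    then show "x \<in> ?E (I \<inter> J)"
    proof cases
      case 1
      then have "?E ?I \<subseteq> ?E (I \<inter> J)" by (intro mono) auto
      with x' show ?thesis by auto
    next
      case 2
      then have "?E J \<subseteq> ?E (I \<inter> J)" by (intro mono) auto
      with x show ?thesis by auto
    qed (use x x' single[of 1] single[of 2] distinct in \<open>auto intro: generate.one\<close>)
  qed
  have edge_face: "?E {0, 1} \<inter> ?E {0, 2} \<subseteq> ?E {0}"
  proof
    fix x assume x: "x \<in> ?E {0, 1} \<inter> ?E {0, 2}"
    obtain y where y: "y \<in> ?E {1}" "\<rho> y = \<rho> x"
      using forget[of x "{0, 1}"] x by auto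
    have "x \<in> {\<one>, s 0, s 2, s 0 \<otimes> s 2}"
      using generate_commuting_involutions[of "s 0" "s 2"] closed square comm x by auto
    moreover have "\<rho> x \<noteq> \<rho> (s 2)"
    proof
      assume "\<rho> x = \<rho> (s 2)"
      with y have "y = s 2"
        using mono[of "{1}" "{1, 2}"] by (intro inj_onD[OF \<rho>_inj]) (auto intro: generate.incl)
      with y show False
        using single[of 1] nontrivial[of 2] distinct by auto
    qed
    moreover have "\<rho> (s 0 \<otimes> s 2) = \<rho> (\<one> \<otimes> s 2)"
      using closed[of 0] closed[of 2] by (simp only: \<rho>_mult \<rho>_0 one_closed)
    ultimately have "x \<in> {\<one>, s 0}"
      using closed by auto
    then show "x \<in> ?E {0}"
      using single[of 0] by auto
  qed
  have ip: "?E I \<inter> ?E J \<subseteq> ?E (I \<inter> J)" if I: "I \<subseteq> {..<3}" and J: "J \<subseteq> {..<3}" for I J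
  proof -
    have "I \<subseteq> {0, 1, 2}" "J \<subseteq> {0, 1, 2}"
      using I J by (auto simp: subset_iff less_Suc_eq numeral_3_eq_3)
    then have "0 \<notin> J \<or> 0 \<notin> I \<or> I \<subseteq> J \<or> J \<subseteq> I \<or> (I = {0, 1} \<and> J = {0, 2}) \<or> (I = {0, 2} \<and> J = {0, 1})"
      unfolding Pow_iff[symmetric] by (simp only: Pow_insert Pow_empty) auto
    then consider "0 \<notin> J" | "0 \<notin> I" | "I \<subseteq> J" | "J \<subseteq> I" | "I = {0, 1}" "J = {0, 2}"
      | "I = {0, 2}" "J = {0, 1}"
      by blast
    then show ?thesis
    proof cases
      case 1
      then show ?thesis using part I J by blast
    next
      case 2
      then show ?thesis using part[OF J I] by (simp add: Int_commute)
    next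
      case 3
      then show ?thesis by (simp add: Int_absorb2)
    next
      case 4
      then show ?thesis by (simp add: Int_absorb1)
    qed (use edge_face in auto)
  qed
  show ?thesis
  proof
    fix i j assume "i + 2 \<le> j" "j < (3::nat)"
    then have "i = 0" "j = 2" by auto
    then show "s i \<otimes> s j = s j \<otimes> s i" using comm by simp
  next
    fix I J assume IJ: "I \<subseteq> {..<(3::nat)}" "J \<subseteq> {..<(3::nat)}"
    show "?E I \<inter> ?E J = ?E (I \<inter> J)"
      using ip[OF IJ] mono[of "I \<inter> J" I] mono[of "I \<inter> J" J] by auto
  qed (use closed nontrivial square generate in auto)
qed

text \<open>
  The injection into the natural numbers is arbitrary.  The result keeps the decoding map \<open>dec\<close>,
  so that all computations can take place with the permutations themselves.
\<close>

lemma finite_permutation_group_nat_copy: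
  assumes "finite Y"
  obtains P :: "nat monoid" and dec :: "nat \<Rightarrow> 'y \<Rightarrow> 'y"
  where "group P" "finite (carrier P)" "bij_betw dec (carrier P) {f. f permutes Y}"
    "dec \<one>\<^bsub>P\<^esub> = id"
    "\<And>x y. x \<in> carrier P \<Longrightarrow> y \<in> carrier P \<Longrightarrow> dec (x \<otimes>\<^bsub>P\<^esub> y) = dec x \<circ> dec y"
proof -
  let ?C = "{f. f permutes Y}"
  have fin: "finite ?C"
    using assms by (rule finite_permutations)
  then obtain enc :: "('y \<Rightarrow> 'y) \<Rightarrow> nat" where enc: "inj_on enc ?C"
    using finite_imp_inj_to_nat_seg by blast
  define dec where "dec = inv_into ?C enc"
  define P where "P = \<lparr>carrier = enc ` ?C, mult = \<lambda>x y. enc (dec x \<circ> dec y), one = enc id\<rparr>"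
  have dec_enc: "dec (enc f) = f" if "f permutes Y" for f
    using that enc by (simp add: dec_def)
  have "group P"
  proof (rule groupI)
    fix x assume "x \<in> carrier P"
    then obtain f where f: "f permutes Y" "x = enc f"
      by (auto simp: P_def)
    then show "\<exists>y\<in>carrier P. y \<otimes>\<^bsub>P\<^esub> x = \<one>\<^bsub>P\<^esub>"
      by (intro bexI[of _ "enc (inv_into UNIV f)"])
        (auto simp: P_def dec_enc permutes_inv permutes_inv_o)
  qed (auto simp: P_def dec_enc permutes_compose permutes_id comp_assoc)
  moreover have "bij_betw dec (carrier P) ?C"
    unfolding dec_def P_def by (simp add: bij_betw_inv_into enc inj_on_imp_bij_betw)
  ultimately show ?thesis
    using fin by (intro that[of P dec]) (auto simp: P_def dec_enc permutes_compose permutes_id)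
qed

section \<open>Monomial representations over the Gaussian units\<close>

text \<open>
  A complex monomial representation with coefficients in \<open>{1, i, -1, -i}\<close>, written without
  complex numbers.  The set \<open>Y\<close> stands for the vectors \<open>i\<^sup>k x\<close>, where \<open>x\<close> runs through a basis,
  \<open>J\<close> is multiplication by the imaginary unit and \<open>J \<circ> J\<close> is negation.  Group elements act on
  \<open>Y\<close> by permutations that commute with \<open>J\<close>.  By \<open>separating\<close>, each basis line other than that of
  \<open>y\<^sub>0\<close> is told apart from the line of \<open>y\<^sub>0\<close> by a diagonal group element with entries \<open>\<plusminus>1\<close>
  that negates \<open>y\<^sub>0\<close>.
\<close>

locale signed_permutation_action = group G for G (structure) +
  fixes Y :: "'y set" and \<pi> :: "'a \<Rightarrow> 'y \<Rightarrow> 'y" and J :: "'y \<Rightarrow> 'y" and y\<^sub>0 :: 'y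
  assumes finite_Y: "finite Y"
    and \<pi>_closed: "g \<in> carrier G \<Longrightarrow> y \<in> Y \<Longrightarrow> \<pi> g y \<in> Y"
    and \<pi>_one: "y \<in> Y \<Longrightarrow> \<pi> \<one> y = y"
    and \<pi>_mult: "g \<in> carrier G \<Longrightarrow> h \<in> carrier G \<Longrightarrow> y \<in> Y \<Longrightarrow> \<pi> (g \<otimes> h) y = \<pi> g (\<pi> h y)"
    and J_closed: "y \<in> Y \<Longrightarrow> J y \<in> Y"
    and J4: "y \<in> Y \<Longrightarrow> J (J (J (J y))) = y"
    and J2_neq: "y \<in> Y \<Longrightarrow> J (J y) \<noteq> y"
    and \<pi>_J: "g \<in> carrier G \<Longrightarrow> y \<in> Y \<Longrightarrow> \<pi> g (J y) = J (\<pi> g y)"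
    and base: "y\<^sub>0 \<in> Y"
    and transitive: "y \<in> Y \<Longrightarrow> \<exists>g\<in>carrier G. \<pi> g y\<^sub>0 = y"
    and separating: "z \<in> Y \<Longrightarrow> z \<notin> {y\<^sub>0, J y\<^sub>0, J (J y\<^sub>0), J (J (J y\<^sub>0))} \<Longrightarrow>
      \<exists>d\<in>carrier G. (\<forall>y\<in>Y. \<pi> d y = y \<or> \<pi> d y = J (J y)) \<and> \<pi> d y\<^sub>0 = J (J y\<^sub>0) \<and> \<pi> d z = z"
begin

text \<open>
  The representation space is the space of functions on \<open>Y\<close> that are odd with respect to
  \<open>J \<circ> J\<close>.  It is a subspace of the real permutation module on \<open>Y\<close>, so that the action is by
  orthogonal maps; precomposition with \<open>J\<close> is a complex structure \<open>\<iota>\<close> on it that commutes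
  with the group.
\<close>

definition vec :: "('y \<Rightarrow> real) \<Rightarrow> 'y \<Rightarrow>\<^sub>0 real"
  where "vec f = Abs_poly_mapping (\<lambda>y. if y \<in> Y then f y else 0)"

definition V :: "('y \<Rightarrow>\<^sub>0 real) set"
  where "V = {v. Poly_Mapping.keys v \<subseteq> Y \<and>
    (\<forall>y\<in>Y. Poly_Mapping.lookup v (J (J y)) = - Poly_Mapping.lookup v y)}"

definition act :: "('y \<Rightarrow>\<^sub>0 real) \<Rightarrow> 'a \<Rightarrow> 'y \<Rightarrow>\<^sub>0 real"
  where "act v g = vec (\<lambda>y. Poly_Mapping.lookup v (\<pi> g y))"

definition \<iota> :: "('y \<Rightarrow>\<^sub>0 real) \<Rightarrow> 'y \<Rightarrow>\<^sub>0 real"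
  where "\<iota> v = vec (\<lambda>y. Poly_Mapping.lookup v (J y))"

definition e :: "'y \<Rightarrow> 'y \<Rightarrow>\<^sub>0 real"
  where "e y = vec (\<lambda>z. (if z = y then 1 else 0) - (if z = J (J y) then 1 else 0))"

lemma lookup_vec [simp]: "Poly_Mapping.lookup (vec f) y = (if y \<in> Y then f y else 0)"
proof -
  have "finite {y. (if y \<in> Y then f y else 0) \<noteq> 0}"
    by (rule finite_subset[OF _ finite_Y]) auto
  then show ?thesis by (simp add: vec_def)
qed

lemma V_iff: "v \<in> V \<longleftrightarrow> (\<forall>y. y \<notin> Y \<longrightarrow> Poly_Mapping.lookup v y = 0) \<and>
    (\<forall>y\<in>Y. Poly_Mapping.lookup v (J (J y)) = - Poly_Mapping.lookup v y)"
  by (auto simp: V_def in_keys_iff subset_iff)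

lemma vec_eqI:
  assumes "v \<in> V" "w \<in> V" "\<And>y. y \<in> Y \<Longrightarrow> Poly_Mapping.lookup v y = Poly_Mapping.lookup w y"
  shows "v = w"
  by (rule poly_mapping_eqI) (use assms in \<open>metis V_iff\<close>)

lemma lookup_J2: "v \<in> V \<Longrightarrow> y \<in> Y \<Longrightarrow>
    Poly_Mapping.lookup v (J (J y)) = - Poly_Mapping.lookup v y"
  by (simp add: V_iff)

lemma J_eq_iff: "y \<in> Y \<Longrightarrow> z \<in> Y \<Longrightarrow> J y = J z \<longleftrightarrow> y = z"
  by (metis J4)

lemma J_neq: "y \<in> Y \<Longrightarrow> J y \<noteq> y"
  by (metis J2_neq)

lemma \<pi>_inv: "g \<in> carrier G \<Longrightarrow> y \<in> Y \<Longrightarrow> \<pi> g (\<pi> (inv g) y) = y"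
    "g \<in> carrier G \<Longrightarrow> y \<in> Y \<Longrightarrow> \<pi> (inv g) (\<pi> g y) = y"
  by (metis \<pi>_mult \<pi>_one inv_closed r_inv) (metis \<pi>_mult \<pi>_one inv_closed l_inv)

lemma bij_betw_\<pi>: "g \<in> carrier G \<Longrightarrow> bij_betw (\<pi> g) Y Y"
  by (rule bij_betw_byWitness[where f' = "\<pi> (inv g)"]) (auto simp: \<pi>_inv \<pi>_closed)

lemma act_in_V: "v \<in> V \<Longrightarrow> g \<in> carrier G \<Longrightarrow> act v g \<in> V"
  by (simp add: V_iff act_def \<pi>_closed J_closed \<pi>_J)

lemma \<iota>_in_V: "v \<in> V \<Longrightarrow> \<iota> v \<in> V"
  by (simp add: V_iff \<iota>_def J_closed)

lemma e_in_V: "y \<in> Y \<Longrightarrow> e y \<in> V"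
  by (auto simp: V_iff e_def J_closed J_eq_iff J4)

lemma subspace_V: "real_vector.subspace V"
  by (rule real_vector.subspaceI) (auto simp: V_iff lookup_add)

lemma RG_module_V: "RG_module G V act"
proof
  show "real_vector.subspace V" by (rule subspace_V)
next
  fix v assume "v \<in> V"
  then show "act v \<one> = v"
    by (intro vec_eqI act_in_V) (auto simp: act_def \<pi>_one)
next
  fix v g h assume "v \<in> V" "g \<in> carrier G" "h \<in> carrier G"
  then show "act v (g \<otimes> h) = act (act v g) h"
    by (intro vec_eqI act_in_V) (auto simp: act_def \<pi>_mult \<pi>_closed)
qed (simp_all add: act_in_V subspace_V, (intro poly_mapping_eqI, simp add: act_def lookup_add)+)

sublocale module: RG_module G V act
  by (rule RG_module_V)

lemma \<iota>_\<iota>: "v \<in> V \<Longrightarrow> \<iota> (\<iota> v) = - v"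
  by (rule poly_mapping_eqI) (auto simp: \<iota>_def J_closed V_iff)

lemma \<iota>_add: "\<iota> (v + w) = \<iota> v + \<iota> w" and \<iota>_scaleR: "\<iota> (r *\<^sub>R v) = r *\<^sub>R \<iota> v"
  by (rule poly_mapping_eqI; simp add: \<iota>_def lookup_add)+

lemma \<iota>_diff: "\<iota> (v - w) = \<iota> v - \<iota> w"
  by (rule poly_mapping_eqI) (simp add: \<iota>_def lookup_minus)

lemma \<iota>_act: "v \<in> V \<Longrightarrow> g \<in> carrier G \<Longrightarrow> \<iota> (act v g) = act (\<iota> v) g"
  by (rule poly_mapping_eqI) (simp add: \<iota>_def act_def \<pi>_closed J_closed \<pi>_J)

lemma act_e:
  assumes "g \<in> carrier G" "y \<in> Y"
  shows "act (e (\<pi> g y)) g = e y"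
proof (rule vec_eqI)
  fix z assume z: "z \<in> Y"
  have "\<pi> g z = \<pi> g w \<longleftrightarrow> z = w" if "w \<in> Y" for w
    using that z assms by (metis \<pi>_inv(2))
  from this[of y] this[of "J (J y)"]
  show "Poly_Mapping.lookup (act (e (\<pi> g y)) g) z = Poly_Mapping.lookup (e y) z"
    using z assms by (simp add: act_def e_def \<pi>_closed J_closed \<pi>_J)
qed (use assms in \<open>auto intro: act_in_V e_in_V \<pi>_closed\<close>)

lemma e_orbit:
  assumes "y \<in> Y"
  obtains g where "g \<in> carrier G" "act (e y\<^sub>0) g = e y"
proof -
  obtain h where h: "h \<in> carrier G" "\<pi> h y\<^sub>0 = y"
    using transitive assms by blast
  then have "act (e y\<^sub>0) (inv h) = e y"
    using act_e[of "inv h" y] assms by (metis \<pi>_inv(2) base inv_closed)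
  with h show ?thesis by (intro that[of "inv h"]) auto
qed

text \<open>
  The functions \<open>e y\<close> for \<open>y \<in> Y\<close> form a single orbit of the group, so that the spanning
  property below reduces statements about the module to the single vector \<open>e y\<^sub>0\<close>.
\<close>

lemma V_eq_span: "V = real_vector.span (e ` Y)"
proof
  show "real_vector.span (e ` Y) \<subseteq> V"
    by (rule real_vector.span_minimal) (auto intro: e_in_V subspace_V)
  show "V \<subseteq> real_vector.span (e ` Y)"
  proof
    fix v assume v: "v \<in> V"
    \<comment> \<open>The factor 1/2 appears because \<open>e (J (J y)) = - e y\<close>: every real line spanned by some \<open>e y\<close> occurs twice in the sum.\<close>
    have "v = (1/2) *\<^sub>R (\<Sum>y\<in>Y. Poly_Mapping.lookup v y *\<^sub>R e y)"
    proof (rule poly_mapping_eqI)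
      fix z
      show "Poly_Mapping.lookup v z =
        Poly_Mapping.lookup ((1/2) *\<^sub>R (\<Sum>y\<in>Y. Poly_Mapping.lookup v y *\<^sub>R e y)) z"
      proof (cases "z \<in> Y")
        case True
        have "Poly_Mapping.lookup (e y) z = (if y = z then 1 else 0) - (if y = J (J z) then 1 else 0)"
          if "y \<in> Y" for y
        proof -
          have "z = J (J y) \<longleftrightarrow> y = J (J z)"
            using that True by (metis J4)
          then show ?thesis
            using True by (simp add: e_def eq_commute)
        qed
        then have "(\<Sum>y\<in>Y. Poly_Mapping.lookup v y * Poly_Mapping.lookup (e y) z) =
          (\<Sum>y\<in>Y. (if y = z then Poly_Mapping.lookup v y else 0)
            - (if y = J (J z) then Poly_Mapping.lookup v y else 0))"
          by (intro sum.cong) auto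
        also have "\<dots> = Poly_Mapping.lookup v z - Poly_Mapping.lookup v (J (J z))"
          using True finite_Y by (simp add: sum_subtractf J_closed)
        finally show ?thesis
          using v True by (simp add: lookup_sum lookup_J2)
      qed (use v in \<open>auto simp: lookup_sum e_def V_iff\<close>)
    qed
    then show "v \<in> real_vector.span (e ` Y)"
      by (metis (mono_tags, lifting) imageI real_vector.span_base real_vector.span_scale
          real_vector.span_sum)
  qed
qed

lemma euclidean: "euclidean_G_space G V act"
proof
  show "\<exists>B. finite B \<and> real_vector.span B = V"
    using V_eq_span finite_Y by blast
next
  fix v w g assume vw: "v \<in> V" "w \<in> V" and g: "g \<in> carrier G"
  have inner: "inner v w = (\<Sum>y\<in>Y. Poly_Mapping.lookup v y * Poly_Mapping.lookup w y)"
    if "v \<in> V" "w \<in> V" for v w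
    using that by (subst inner_poly_mapping_superset[OF finite_Y]) (auto simp: V_def)
  show "inner (act v g) (act w g) = inner v w"
    using vw g sum.reindex_bij_betw[OF bij_betw_\<pi>[OF g],
        of "\<lambda>y. Poly_Mapping.lookup v y * Poly_Mapping.lookup w y"]
    by (simp add: inner act_in_V) (simp add: act_def)
qed

definition cscale :: "complex \<Rightarrow> ('y \<Rightarrow>\<^sub>0 real) \<Rightarrow> 'y \<Rightarrow>\<^sub>0 real"
  where "cscale z = (\<lambda>v\<in>V. Re z *\<^sub>R v + Im z *\<^sub>R \<iota> v)"

lemma cscale_in_End: "cscale z \<in> carrier (RG_End G V act)"
  unfolding cscale_def
  by (rule module.RG_End_memI)
    (simp_all add: module.add_mem module.scaleR_mem \<iota>_in_V \<iota>_add \<iota>_scaleR act_in_V \<iota>_act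
      module.act_add module.act_scaleR algebra_simps)

lemma lookup_cscale: "v \<in> V \<Longrightarrow> y \<in> Y \<Longrightarrow> Poly_Mapping.lookup (cscale z v) y =
    Re z * Poly_Mapping.lookup v y + Im z * Poly_Mapping.lookup v (J y)"
  by (simp add: cscale_def lookup_add \<iota>_def)

lemma cscale_add: "v \<in> V \<Longrightarrow> cscale (z + w) v = cscale z v + cscale w v"
  by (simp add: cscale_def algebra_simps)

lemma cscale_mult: "v \<in> V \<Longrightarrow> cscale (z * w) v = cscale z (cscale w v)"
  by (simp add: cscale_def \<iota>_in_V module.add_mem module.scaleR_mem \<iota>_add \<iota>_scaleR \<iota>_\<iota> algebra_simps)

lemma e_base:
  "Poly_Mapping.lookup (e y\<^sub>0) y\<^sub>0 = 1" "Poly_Mapping.lookup (e y\<^sub>0) (J y\<^sub>0) = 0"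
  using base J2_neq[OF base] J_neq[OF base] J_neq[OF J_closed[OF base]] J_closed[OF base]
  by (auto simp: e_def)

lemma e_off_orbit:
  assumes "y \<in> Y" "y \<notin> {y\<^sub>0, J y\<^sub>0, J (J y\<^sub>0), J (J (J y\<^sub>0))}"
  shows "Poly_Mapping.lookup (e y\<^sub>0) y = 0" "Poly_Mapping.lookup (e y\<^sub>0) (J y) = 0"
proof -
  have "J y \<notin> {y\<^sub>0, J (J y\<^sub>0)}"
    using assms base J_eq_iff[of y "J y\<^sub>0"] J_eq_iff[of y "J (J (J y\<^sub>0))"]
    by (auto simp: J_closed J4)
  with assms show "Poly_Mapping.lookup (e y\<^sub>0) y = 0" "Poly_Mapping.lookup (e y\<^sub>0) (J y) = 0"
    by (auto simp: e_def)
qed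

lemma \<iota>_e: "y \<in> Y \<Longrightarrow> \<iota> (e y) = - e (J y)"
proof (rule poly_mapping_eqI)
  fix z assume y: "y \<in> Y"
  show "Poly_Mapping.lookup (\<iota> (e y)) z = Poly_Mapping.lookup (- e (J y)) z"
  proof (cases "z \<in> Y")
    case True
    have "J z = y \<longleftrightarrow> z = J (J (J y))" "J z = J (J y) \<longleftrightarrow> z = J y"
      using True y by (metis J4 J_closed J_eq_iff)+
    with True show ?thesis by (simp add: \<iota>_def e_def J_closed)
  qed (simp add: \<iota>_def e_def)
qed

text \<open>
  If \<open>d\<close> negates \<open>y\<^sub>0\<close>, then it negates \<open>f (e y\<^sub>0)\<close> for every endomorphism \<open>f\<close>; if it also
  fixes \<open>z\<close>, then \<open>f (e y\<^sub>0)\<close> must vanish at \<open>z\<close>.  Hence only the values on the \<open>J\<close>-orbit of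
  \<open>y\<^sub>0\<close> survive, and these amount to one complex number.
\<close>

lemma End_e:
  assumes f: "f \<in> carrier (RG_End G V act)"
  obtains z where "f (e y\<^sub>0) = cscale z (e y\<^sub>0)"
proof
  let ?l = "Poly_Mapping.lookup (f (e y\<^sub>0))"
  let ?z = "Complex (?l y\<^sub>0) (- ?l (J y\<^sub>0))"
  note e0 = e_in_V[OF base]
  note E = module.RG_End_memD[OF f]
  have fe: "f (e y\<^sub>0) \<in> V"
    using E(1) e0 .
  show "f (e y\<^sub>0) = cscale ?z (e y\<^sub>0)"
  proof (rule vec_eqI)
    show "cscale ?z (e y\<^sub>0) \<in> V"
      using module.RG_End_memD(1)[OF cscale_in_End] e0 .
    fix z assume z: "z \<in> Y"
    show "?l z = Poly_Mapping.lookup (cscale ?z (e y\<^sub>0)) z"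
    proof (cases "z \<in> {y\<^sub>0, J y\<^sub>0, J (J y\<^sub>0), J (J (J y\<^sub>0))}")
      case True
      then show ?thesis
        using fe e0 base e_base by (auto simp: lookup_cscale J_closed lookup_J2 J4)
    next
      case False
      then obtain d where d: "d \<in> carrier G" "\<pi> d y\<^sub>0 = J (J y\<^sub>0)" "\<pi> d z = z"
        using separating z by blast
      have "act (e y\<^sub>0) d = - 1 *\<^sub>R e y\<^sub>0"
      proof (rule vec_eqI)
        show "- 1 *\<^sub>R e y\<^sub>0 \<in> V"
          using e0 module.scaleR_mem by blast
        have "act (e (J (J y\<^sub>0))) d = e y\<^sub>0"
          using act_e[of d y\<^sub>0] d base by simp
        moreover have "e (J (J y\<^sub>0)) = - 1 *\<^sub>R e y\<^sub>0"
          by (rule poly_mapping_eqI) (simp add: e_def J4 base)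
        ultimately have "act (- 1 *\<^sub>R e y\<^sub>0) d = e y\<^sub>0" by simp
        then have "- 1 *\<^sub>R act (e y\<^sub>0) d = e y\<^sub>0"
          using e0 d(1) by (metis module.act_scaleR)
        then show "Poly_Mapping.lookup (act (e y\<^sub>0) d) y = Poly_Mapping.lookup (- 1 *\<^sub>R e y\<^sub>0) y" for y
          by (metis add.inverse_inverse scaleR_minus1_left)
      qed (use e0 d in \<open>auto intro: act_in_V\<close>)
      then have "act (f (e y\<^sub>0)) d = - 1 *\<^sub>R f (e y\<^sub>0)"
        using E(4,5) e0 d(1) by metis
      then have "Poly_Mapping.lookup (act (f (e y\<^sub>0)) d) z = - ?l z" by simp
      then have "?l z = 0"
        using z d by (simp add: act_def)
      then show ?thesis
        using z e0 e_off_orbit[OF z False] by (simp add: lookup_cscale)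
    qed
  qed (rule fe)
qed

lemma End_eq_cscale:
  assumes f: "f \<in> carrier (RG_End G V act)"
  obtains z where "f = cscale z"
proof -
  obtain z where z: "f (e y\<^sub>0) = cscale z (e y\<^sub>0)"
    using End_e[OF f] .
  note E = module.RG_End_memD[OF f] and C = module.RG_End_memD[OF cscale_in_End]
  have "v \<in> V \<and> f v = cscale z v" if "v \<in> real_vector.span (e ` Y)" for v
    using that
  proof (induction rule: real_vector.span_induct_alt)
    case base
    show ?case
      using E(4)[OF module.zero_mem, of 0] C(4)[OF module.zero_mem, of z 0] module.zero_mem by simp
  next
    case (step c x y)
    then obtain w where w: "w \<in> Y" "x = e w" by auto
    obtain g where g: "g \<in> carrier G" "act (e y\<^sub>0) g = e w"
      using e_orbit[OF w(1)] .
    have "f x = cscale z x"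
      using E(5) C(5) z g e_in_V[OF base] w(2) by metis
    with step w show ?case
      by (simp add: E C e_in_V module.scaleR_mem module.add_mem)
  qed
  then have "f = cscale z"
    by (intro module.RG_End_eqI f cscale_in_End) (auto simp: V_eq_span[symmetric])
  then show ?thesis by (rule that)
qed

lemma cscale_inj: "cscale z = cscale w \<Longrightarrow> z = w"
proof -
  assume eq: "cscale z = cscale w"
  show "z = w"
    using lookup_cscale[of "e y\<^sub>0" y\<^sub>0 z] lookup_cscale[of "e y\<^sub>0" "J y\<^sub>0" z]
      lookup_cscale[of "e y\<^sub>0" y\<^sub>0 w] lookup_cscale[of "e y\<^sub>0" "J y\<^sub>0" w]
      eq base lookup_J2[OF e_in_V[OF base] base] e_base
    by (simp add: e_in_V J_closed complex_eq_iff)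
qed

lemma complex_type_V: "complex_type G V act"
proof -
  let ?E = "RG_End G V act"
  let ?\<phi> = "the_inv cscale"
  have inj: "inj cscale"
    using cscale_inj by (rule injI)
  have \<phi>: "?\<phi> (cscale z) = z" for z
    using the_inv_f_f[OF inj] .
  have carrier: "carrier ?E = range cscale"
    using cscale_in_End End_eq_cscale by blast
  have mult: "cscale z \<otimes>\<^bsub>?E\<^esub> cscale w = cscale (z * w)" for z w
    by (rule module.RG_End_eqI)
      (simp_all add: module.RG_End_simps module.RG_End_closed cscale_in_End cscale_mult)
  have add: "cscale z \<oplus>\<^bsub>?E\<^esub> cscale w = cscale (z + w)" for z w
    by (rule module.RG_End_eqI)
      (simp_all add: module.RG_End_simps module.RG_End_closed cscale_in_End cscale_add)
  have real: "(\<lambda>x\<in>V. r *\<^sub>R x) = cscale (of_real r)" for r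
    by (auto simp: cscale_def)
  then have one: "\<one>\<^bsub>?E\<^esub> = cscale 1"
    using real[of 1] by (simp add: module.RG_End_simps)
  have "bij_betw ?\<phi> (carrier ?E) (carrier complex_ring)"
    by (rule bij_betw_byWitness[where f' = cscale]) (auto simp: carrier \<phi> complex_ring_def)
  then have "?\<phi> \<in> ring_iso ?E complex_ring"
    by (auto simp: ring_iso_def ring_hom_def carrier \<phi> mult add one) (auto simp: complex_ring_def)
  then show ?thesis
    unfolding complex_type_def by (intro bexI[of _ ?\<phi>]) (simp_all add: real \<phi>)
qed

text \<open>
  A nonzero submodule contains a vector \<open>u\<close> that does not vanish at \<open>y\<^sub>0\<close>.  Replacing \<open>u\<close> by
  \<open>u - u d\<close>, where \<open>d\<close> negates \<open>y\<^sub>0\<close> and fixes \<open>z\<close>, doubles the value at \<open>y\<^sub>0\<close>, creates the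
  value \<open>0\<close> at \<open>z\<close> and destroys no zero, because \<open>d\<close> is diagonal.  After finitely many such steps
  \<open>u\<close> is a nonzero complex multiple of \<open>e y\<^sub>0\<close>.  A group element that sends \<open>y\<^sub>0\<close> to \<open>J y\<^sub>0\<close>
  multiplies \<open>e y\<^sub>0\<close> by the imaginary unit, so that the multiple can be normalized to
  \<open>e y\<^sub>0\<close> inside the submodule.
\<close>

lemma simple_V: "simple_RG_module G V act"
proof
  show "V \<noteq> {0}"
    using e_in_V[OF base] e_base(1) by auto
next
  fix U assume U: "real_vector.subspace U" "U \<subseteq> V" and inv: "\<forall>u\<in>U. \<forall>g\<in>carrier G. act u g \<in> U"
  show "U = {0} \<or> U = V"
  proof (cases "U = {0}")
    case False
    then obtain u where u: "u \<in> U" "u \<noteq> 0"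
      using real_vector.subspace_0[OF U(1)] by blast
    then obtain y where y: "y \<in> Y" "Poly_Mapping.lookup u y \<noteq> 0"
      using U(2) by (metis V_iff lookup_zero poly_mapping_eqI subsetD)
    obtain h where h: "h \<in> carrier G" "\<pi> h y\<^sub>0 = y"
      using transitive y by blast
    have start: "\<exists>u\<in>U. Poly_Mapping.lookup u y\<^sub>0 \<noteq> 0"
      using u h y inv base by (intro bexI[of _ "act u h"]) (auto simp: act_def)
    let ?O = "{y\<^sub>0, J y\<^sub>0, J (J y\<^sub>0), J (J (J y\<^sub>0))}"
    have "\<exists>u\<in>U. Poly_Mapping.lookup u y\<^sub>0 \<noteq> 0 \<and> (\<forall>z\<in>F. Poly_Mapping.lookup u z = 0)"
      if "finite F" "F \<subseteq> Y - ?O" for F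
      using that
    proof (induction rule: finite_induct)
      case empty
      then show ?case using start by simp
    next
      case (insert z F)
      then obtain u where u: "u \<in> U" "Poly_Mapping.lookup u y\<^sub>0 \<noteq> 0"
        "\<forall>z\<in>F. Poly_Mapping.lookup u z = 0"
        by auto
      obtain d where d: "d \<in> carrier G" "\<forall>y\<in>Y. \<pi> d y = y \<or> \<pi> d y = J (J y)"
        "\<pi> d y\<^sub>0 = J (J y\<^sub>0)" "\<pi> d z = z"
        using separating[of z] insert.prems by blast
      have uV: "u \<in> V" using u U by blast
      have "u - act u d \<in> U"
        using u inv d U by (auto intro: real_vector.subspace_diff)
      moreover have "Poly_Mapping.lookup (u - act u d) y\<^sub>0 \<noteq> 0"
        using d u uV base by (simp add: lookup_minus act_def lookup_J2)
      moreover have "Poly_Mapping.lookup (u - act u d) w = 0" if "w \<in> insert z F" for w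
      proof (cases "w = z")
        case True
        then show ?thesis
          using d insert.prems by (simp add: lookup_minus act_def)
      next
        case False
        then have "Poly_Mapping.lookup u w = 0" "w \<in> Y"
          using that u insert.prems by auto
        then show ?thesis
          using d(2) uV by (auto simp: lookup_minus act_def lookup_J2)
      qed
      ultimately show ?case by blast
    qed
    from this[of "Y - ?O"] finite_Y
    obtain u where u: "u \<in> U" "Poly_Mapping.lookup u y\<^sub>0 \<noteq> 0"
      "\<forall>z\<in>Y - ?O. Poly_Mapping.lookup u z = 0"
      by auto
    have uV: "u \<in> V" using u U by blast
    define \<alpha> \<beta> where "\<alpha> = Poly_Mapping.lookup u y\<^sub>0" and "\<beta> = Poly_Mapping.lookup u (J y\<^sub>0)"
    obtain k where k: "k \<in> carrier G" "\<pi> k y\<^sub>0 = J y\<^sub>0"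
      using transitive[OF J_closed[OF base]] by blast
    let ?z = "Complex \<alpha> (- \<beta>)"
    note e0 = e_in_V[OF base]
    note C = module.RG_End_memD[OF cscale_in_End]
    have u_eq: "u = cscale ?z (e y\<^sub>0)"
    proof (rule vec_eqI)
      fix y assume y: "y \<in> Y"
      show "Poly_Mapping.lookup u y = Poly_Mapping.lookup (cscale ?z (e y\<^sub>0)) y"
      proof (cases "y \<in> ?O")
        case True
        then show ?thesis
          using uV e0 base e_base C(1)[OF e0, of ?z]
          by (auto simp: lookup_cscale J_closed lookup_J2 J4 \<alpha>_def \<beta>_def)
      next
        case False
        then show ?thesis
          using u(3) y e0 e_off_orbit[OF y] by (simp add: lookup_cscale)
      qed
    qed (use uV C(1)[OF e0] in auto)
    have "act (\<iota> (e y\<^sub>0)) k = - e y\<^sub>0"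
      using act_e[OF k(1) base] module.act_scaleR[of "e (J y\<^sub>0)" k "-1"] k
      by (simp add: \<iota>_e base e_in_V J_closed)
    then have "act (\<iota> (e y\<^sub>0)) k = \<iota> (\<iota> (e y\<^sub>0))"
      using e0 by (simp add: \<iota>_\<iota>)
    then have "\<iota> (act (e y\<^sub>0) k) = \<iota> (\<iota> (e y\<^sub>0))"
      using \<iota>_act e0 k by simp
    then have act_k: "act (e y\<^sub>0) k = \<iota> (e y\<^sub>0)"
      using \<iota>_\<iota> e0 k act_in_V \<iota>_in_V by (metis neg_equal_iff_equal)
    have "act u k = \<iota> u"
      using C(5)[OF e0 k(1), of ?z] e0 unfolding u_eq act_k
      by (simp add: cscale_def \<iota>_in_V \<iota>_diff \<iota>_scaleR)
    then have "\<iota> u \<in> U"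
      using u(1) k(1) inv by metis
    then have "cscale w u \<in> U" for w
      using u uV U by (auto simp: cscale_def intro!: real_vector.subspace_add real_vector.subspace_scale)
    moreover have "cscale (inverse ?z) u = e y\<^sub>0"
    proof -
      have "?z \<noteq> 0"
        using u(2) by (simp add: \<alpha>_def complex_eq_iff)
      then show ?thesis
        using cscale_mult[OF e0, of "inverse ?z" ?z] e0 unfolding u_eq by (simp add: cscale_def)
    qed
    ultimately have "e y\<^sub>0 \<in> U" by metis
    then have "e ` Y \<subseteq> U"
      using e_orbit inv by (metis image_subsetI)
    then have "V \<subseteq> U"
      unfolding V_eq_span using U(1) by (rule real_vector.span_minimal)
    then show ?thesis using U by auto
  qed simp
qed

section \<open>The fixed space\<close>

text \<open>
  Fixed vectors that are dual to a set \<open>Q\<close> of evaluation points are linearly independent over the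
  complex numbers: evaluating a linear combination at \<open>q\<close> and at \<open>J q\<close> yields the real part and
  the negative of the imaginary part of the coefficient of \<open>W q\<close>.
\<close>

lemma card_le_essential_wythoff_dim:
  assumes H: "H \<subseteq> carrier G" and Q: "finite Q" "Q \<subseteq> Y"
    and W: "\<And>q. q \<in> Q \<Longrightarrow> W q \<in> Fix act V H"
    and W_Q: "\<And>q q'. q \<in> Q \<Longrightarrow> q' \<in> Q \<Longrightarrow> Poly_Mapping.lookup (W q) q' = (if q = q' then 1 else 0)"
    and W_JQ: "\<And>q q'. q \<in> Q \<Longrightarrow> q' \<in> Q \<Longrightarrow> Poly_Mapping.lookup (W q) (J q') = 0"
  shows "card Q \<le> essential_wythoff_dim G H V act"
proof -
  let ?E = "RG_End G V act" and ?M = "wythoff_module act V H"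
  interpret vs: vectorspace ?E ?M
    by (rule module.complex_type_vectorspace[OF complex_type_V H])
  have M: "carrier ?M = Fix act V H" "\<zero>\<^bsub>?M\<^esub> = 0" "x \<oplus>\<^bsub>?M\<^esub> y = x + y" "f \<odot>\<^bsub>?M\<^esub> x = f x" for x y f
    by (simp_all add: wythoff_module_def)
  have FixV: "x \<in> V" if "x \<in> Fix act V H" for x
    using that by (simp add: Fix_def)
  \<comment> \<open>A finite set that spans the fixed space over the reals spans it over the endomorphism ring.\<close>
  have "vs.fin_dim"
  proof -
    obtain B where B: "B \<subseteq> Fix act V H" "\<not> real_vector.dependent B" "Fix act V H \<subseteq> real_vector.span B"
      by (rule real_vector.maximal_independent_subset)
    have "B \<subseteq> real_vector.span (e ` Y)"
      using B(1) FixV V_eq_span by blast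
    then have fin: "finite B"
      using real_vector.independent_span_bound[OF _ B(2), of "e ` Y"] finite_Y by blast
    have BM: "B \<subseteq> carrier ?M" using B(1) M by simp
    have "x \<in> vs.span B" if "x \<in> real_vector.span B" for x
      using that
    proof (induction rule: real_vector.span_induct_alt)
      case base
      show ?case using vs.span_zero by (simp add: M)
    next
      case (step c x y)
      then have "cscale (of_real c) \<odot>\<^bsub>?M\<^esub> x \<in> vs.span B"
        using vs.in_own_span[OF BM] vs.span_is_submodule[OF BM] cscale_in_End
        by (auto simp: submodule_def)
      moreover have "cscale (of_real c) \<odot>\<^bsub>?M\<^esub> x = c *\<^sub>R x"
        using step B(1) FixV by (auto simp: M cscale_def)
      ultimately show ?case
        using vs.span_add1[OF BM _ step.IH] by (simp add: M)
    qed
    then have "vs.gen_set B"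
      using B(3) vs.span_is_subset2[OF BM] M by blast
    with fin BM show ?thesis by (auto simp: vs.fin_dim_def)
  qed
  moreover have inj: "inj_on W Q"
  proof (rule inj_onI)
    fix q q' assume "q \<in> Q" "q' \<in> Q" "W q = W q'"
    then show "q = q'" using W_Q by (metis zero_neq_one)
  qed
  moreover have "vs.lin_indpt (W ` Q)"
  proof (rule vs.finite_lin_indpt2)
    fix a assume a: "a \<in> W ` Q \<rightarrow> carrier ?E" and zero: "vs.lincomb a (W ` Q) = \<zero>\<^bsub>?M\<^esub>"
    have lincomb: "vs.lincomb a B = (\<Sum>x\<in>B. a x x)" if "B \<subseteq> W ` Q" for B
      using finite_subset[OF that finite_imageI[OF Q(1)]] that
    proof (induction rule: finite_induct)
      case empty
      show ?case by (simp add: vs.lincomb_empty M)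
    next
      case (insert x B)
      then have "vs.lincomb a (B \<union> {x}) = a x \<odot>\<^bsub>?M\<^esub> x \<oplus>\<^bsub>?M\<^esub> vs.lincomb a B"
        using a W by (intro vs.lincomb_insert) (auto simp: M)
      with insert show ?case by (simp add: M)
    qed
    have "a (W q) = \<zero>\<^bsub>?E\<^esub>" if q: "q \<in> Q" for q
    proof -
      have "\<exists>z. a (W q) = cscale z" if "q \<in> Q" for q
        using a that End_eq_cscale[of "a (W q)"] by blast
      then obtain z where z: "a (W q) = cscale (z q)" if "q \<in> Q" for q
        by metis
      have WV: "W q \<in> V" if "q \<in> Q" for q
        using W FixV that by blast
      have "(\<Sum>q\<in>Q. cscale (z q) (W q)) = 0"
        using zero lincomb[of "W ` Q"] inj by (simp add: sum.reindex M z)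
      then have sum0: "(\<Sum>q\<in>Q. Poly_Mapping.lookup (cscale (z q) (W q)) y) = 0" for y
        by (metis lookup_sum lookup_zero)
      have "q \<in> Y" using q Q by blast
      have "Poly_Mapping.lookup (cscale (z p) (W p)) q = (if p = q then Re (z q) else 0)"
        "Poly_Mapping.lookup (cscale (z p) (W p)) (J q) = (if p = q then - Im (z q) else 0)"
        if "p \<in> Q" for p
        using that q \<open>q \<in> Y\<close> WV[OF that] W_Q[OF that q] W_JQ[OF that q]
        by (auto simp: lookup_cscale J_closed lookup_J2)
      then have "Re (z q) = 0" "- Im (z q) = 0"
        using sum0[of q] sum0[of "J q"] q Q(1) by (simp_all cong: sum.cong)
      then have "z q = 0" by (simp add: complex_eq_iff)
      then show ?thesis
        using z[OF q] by (auto simp: cscale_def module.RG_End_simps)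
    qed
    then show "\<forall>v\<in>W ` Q. a v = \<zero>\<^bsub>?E\<^esub>" by blast
  qed (use Q W M in auto)
  ultimately have "card (W ` Q) \<le> vs.dim"
    using W by (intro vs.li_le_dim) (auto simp: M)
  then show ?thesis
    using inj by (simp add: essential_wythoff_dim_def card_image)
qed

end

text \<open>
  Wythoff's construction: a fixed vector \<open>w\<close> of \<open>H\<close> yields the realization \<open>H g \<mapsto> w g\<close>, which
  spans a nonzero submodule and hence all of a simple module.
\<close>

lemma pure_realization_on_cosets:
  fixes G (structure)
  assumes simple: "simple_RG_module G V act" and euclidean: "euclidean_G_space G V act"
    and H: "subgroup H G" and w: "w \<in> Fix act V H" "w \<noteq> 0"
  obtains A where "pure_realization G (rcosets H) (\<lambda>\<omega> g. \<omega> #> g) V act A"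
    "real_vector.span (A ` (rcosets H)) = V"
proof -
  interpret S: simple_RG_module G V act by (rule simple)
  interpret E: euclidean_G_space G V act by (rule euclidean)
  interpret H: subgroup H G by (rule H)
  define A where "A = (\<lambda>\<omega>. act w (SOME g. g \<in> \<omega>))"
  have wV: "w \<in> V" and w_fix: "\<And>h. h \<in> H \<Longrightarrow> act w h = w"
    using w by (auto simp: Fix_def)
  have A: "A (H #> g) = act w g" if g: "g \<in> carrier G" for g
  proof -
    have "g \<in> H #> g"
      using S.rcos_self[OF g H] .
    then have "(SOME k. k \<in> H #> g) \<in> H #> g"
      by (rule someI)
    then obtain h where "h \<in> H" "(SOME k. k \<in> H #> g) = h \<otimes> g"
      by (auto simp: r_coset_def)
    then show ?thesis
      using g wV w_fix by (simp add: A_def S.act_mult)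
  qed
  have translate: "H #> g #> k = H #> (g \<otimes> k)" if "g \<in> carrier G" "k \<in> carrier G" for g k
    using that S.coset_mult_assoc[OF H.subset] by simp
  have cosets: "\<omega> \<in> rcosets H \<longleftrightarrow> (\<exists>g\<in>carrier G. \<omega> = H #> g)" for \<omega>
    by (auto simp: RCOSETS_def)
  have real: "realization G (rcosets H) (\<lambda>\<omega> g. \<omega> #> g) V act A"
  proof
    fix \<omega> \<omega>' assume "\<omega> \<in> rcosets H" "\<omega>' \<in> rcosets H"
    then obtain g k where gk: "g \<in> carrier G" "k \<in> carrier G" "\<omega> = H #> g" "\<omega>' = H #> k"
      by (auto simp: cosets)
    then have "\<omega> #> (inv g \<otimes> k) = \<omega>'"
      by (simp add: translate S.m_assoc[symmetric])
    with gk show "\<exists>g\<in>carrier G. \<omega> #> g = \<omega>'" by blast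
  next
    show "rcosets H \<noteq> {}"
      using cosets by blast
  qed (auto simp: cosets translate A wV S.act_closed S.act_mult S.m_assoc)
  have "real_vector.span (A ` (rcosets H)) = {0} \<or> real_vector.span (A ` (rcosets H)) = V"
  proof (rule S.simple)
    have A_V: "A ` (rcosets H) \<subseteq> V"
      by (auto simp: cosets A wV S.act_closed)
    then show span_V: "real_vector.span (A ` (rcosets H)) \<subseteq> V"
      using S.subspace by (rule real_vector.span_minimal)
    have "x \<in> V \<and> act x g \<in> real_vector.span (A ` (rcosets H))"
      if "x \<in> real_vector.span (A ` (rcosets H))" "g \<in> carrier G" for x g
      using that(1)
    proof (induction rule: real_vector.span_induct_alt)
      case base
      then show ?case
        using that(2) by (simp add: S.act_zero S.zero_mem real_vector.span_zero)
    next
      case (step c x y)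
      then obtain k where k: "k \<in> carrier G" "x = act w k"
        by (auto simp: cosets A)
      have "act x g = A (H #> (k \<otimes> g))"
        using k that(2) wV by (simp add: A S.act_mult)
      moreover have "H #> (k \<otimes> g) \<in> rcosets H"
        using k that(2) cosets by blast
      ultimately have "act x g \<in> real_vector.span (A ` (rcosets H))"
        by (simp add: real_vector.span_base)
      with step k that(2) wV show ?case
        by (simp add: S.act_add S.act_scaleR S.act_closed S.scaleR_mem S.add_mem
            real_vector.span_add real_vector.span_scale)
    qed
    then show "\<forall>u\<in>real_vector.span (A ` (rcosets H)). \<forall>g\<in>carrier G.
      act u g \<in> real_vector.span (A ` (rcosets H))"
      by blast
  qed (rule real_vector.subspace_span)
  moreover have "w \<in> real_vector.span (A ` (rcosets H))"
  proof -
    have "A (H #> \<one>) = w"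
      using wV by (simp add: A S.act_one)
    moreover have "H #> \<one> \<in> rcosets H"
      by (auto simp: cosets)
    ultimately show ?thesis
      by (metis imageI real_vector.span_base)
  qed
  ultimately have span: "real_vector.span (A ` (rcosets H)) = V"
    using w(2) by auto
  then have "pure_realization G (rcosets H) (\<lambda>\<omega> g. \<omega> #> g) V act A"
    using real simple by (simp add: pure_realization_def pure_realization_axioms_def)
  then show ?thesis
    using span by (rule that)
qed

section \<open>Three involutions twisted by a hexagon\<close>

text \<open>
  Let \<open>p\<close> be a residue modulo \<open>8 m\<close>.  The point \<open>p\<close> of a cycle of length \<open>8 m\<close> represents the
  vector \<open>i\<^sup>k x\<^sub>r\<close> with \<open>p = r + 2 k m\<close>, where \<open>x\<^sub>0, \<dots>, x\<^sub>2\<^sub>m\<^sub>-\<^sub>1\<close> is a basis of a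
  complex space of dimension \<open>2 m\<close>.  Thus \<open>quarter m\<close> and \<open>half m\<close> are multiplication by \<open>i\<close>
  and by \<open>-1\<close>.  The three involutions used on the cycle are the two perfect matchings
  \<open>even_edges\<close> and \<open>odd_edges m\<close>, which together act transitively on the cycle, and the
  reflection \<open>sign m\<close> that negates \<open>x\<^sub>0\<close>.
\<close>

definition quarter :: "nat \<Rightarrow> nat \<Rightarrow> nat"
  where "quarter m p = (if p < 6 * m then p + 2 * m else p - 6 * m)"

definition half :: "nat \<Rightarrow> nat \<Rightarrow> nat"
  where "half m p = (if p < 4 * m then p + 4 * m else p - 4 * m)"

definition even_edges :: "nat \<Rightarrow> nat"
  where "even_edges p = (if even p then p + 1 else p - 1)"

definition odd_edges :: "nat \<Rightarrow> nat \<Rightarrow> nat"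
  where "odd_edges m p =
    (if p = 0 then 8 * m - 1 else if p = 8 * m - 1 then 0 else if odd p then p + 1 else p - 1)"

definition sign :: "nat \<Rightarrow> nat \<Rightarrow> nat"
  where "sign m p = (if p \<in> {0, 2 * m, 4 * m, 6 * m} then half m p else p)"

text \<open>
  Six copies of the cycle are arranged around a hexagon.  The generator \<open>gen m 0\<close> acts in each copy
  by \<open>block m j\<close>; the generators \<open>gen m 1\<close> and \<open>gen m 2\<close> permute the copies by the two reflections
  of the hexagon.  The sequence \<open>block m\<close> is invariant under \<open>j \<mapsto> -j\<close> modulo \<open>6\<close>, which makes
  \<open>gen m 0\<close> commute with \<open>gen m 2\<close>.  The sign is at distance \<open>1\<close> from \<open>even_edges\<close> and at distance
  \<open>3\<close> from \<open>odd_edges m\<close>, whereas the two matchings are at distance \<open>2\<close>: at each of the distances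
  \<open>1\<close> and \<open>3\<close> only one pair of noncommuting involutions occurs.
\<close>

definition block :: "nat \<Rightarrow> nat \<Rightarrow> nat \<Rightarrow> nat"
  where "block m j = (if j = 0 then sign m else if j = 1 \<or> j = 5 then even_edges
    else if j = 3 then odd_edges m else id)"

definition points :: "nat \<Rightarrow> (nat \<times> nat) set"
  where "points m = {..<6} \<times> {..<8 * m}"

fun gen :: "nat \<Rightarrow> nat \<Rightarrow> nat \<times> nat \<Rightarrow> nat \<times> nat"
  where "gen m i (j, p) = (if (j, p) \<notin> points m then (j, p)
    else if i = 0 then (j, block m j p)
    else if i = 1 then ((7 - j) mod 6, p)
    else ((6 - j) mod 6, p))"

text \<open>
  As the generators are involutions, this is the group that they generate; closure under
  composition is all that is needed to exhibit elements of it.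
\<close>

inductive_set words :: "nat \<Rightarrow> (nat \<times> nat \<Rightarrow> nat \<times> nat) set" for m
  where id: "id \<in> words m"
    | gen: "i < 3 \<Longrightarrow> gen m i \<in> words m"
    | comp: "f \<in> words m \<Longrightarrow> g \<in> words m \<Longrightarrow> f \<circ> g \<in> words m"

lemma less_6_cases: "(j::nat) < 6 \<Longrightarrow> j = 0 \<or> j = 1 \<or> j = 2 \<or> j = 3 \<or> j = 4 \<or> j = 5"
  by linarith

lemma less_3_cases: "(i::nat) < 3 \<Longrightarrow> i = 0 \<or> i = 1 \<or> i = 2"
  by linarith

context
  fixes m :: nat
  assumes m: "m \<ge> 2"
begin

lemma quarter_less: "p < 8 * m \<Longrightarrow> quarter m p < 8 * m"
  by (auto simp: quarter_def)

lemma quarter_quarter: "p < 8 * m \<Longrightarrow> quarter m (quarter m p) = half m p"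
  using m by (auto simp: quarter_def half_def)

lemma half_less: "p < 8 * m \<Longrightarrow> half m p < 8 * m"
  by (auto simp: half_def)

lemma half_half: "p < 8 * m \<Longrightarrow> half m (half m p) = p"
  using m by (auto simp: half_def)

lemma half_neq: "half m p \<noteq> p"
  using m by (auto simp: half_def)

lemma even_edges:
  assumes "p < 8 * m"
  shows "even_edges p < 8 * m" "even_edges (even_edges p) = p"
    "even_edges (quarter m p) = quarter m (even_edges p)"
proof -
  have *: "p + 1 < 8 * m" if "even p"
    using that assms by presburger
  then show "even_edges p < 8 * m"
    using assms by (auto simp: even_edges_def)
  show "even_edges (even_edges p) = p"
    by (auto simp: even_edges_def)
  have "p + 1 < 6 * m" if "even p" "p < 6 * m"
    using that by presburger
  moreover have "p - 1 \<ge> 6 * m" if "odd p" "\<not> p < 6 * m"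
    using that by presburger
  ultimately show "even_edges (quarter m p) = quarter m (even_edges p)"
    using * assms by (auto simp: even_edges_def quarter_def dest: odd_pos)
qed

lemma odd_edges_simps:
  "odd_edges m 0 = 8 * m - 1" "odd_edges m (8 * m - 1) = 0"
  "odd p \<Longrightarrow> p \<noteq> 8 * m - 1 \<Longrightarrow> odd_edges m p = p + 1"
  "even p \<Longrightarrow> p \<noteq> 0 \<Longrightarrow> odd_edges m p = p - 1"
proof -
  have "odd (8 * m - 1)"
    using m by presburger
  then show "even p \<Longrightarrow> p \<noteq> 0 \<Longrightarrow> odd_edges m p = p - 1"
    by (auto simp: odd_edges_def)
qed (auto simp: odd_edges_def intro: odd_pos)

lemma odd_edges:
  assumes "p < 8 * m"
  shows "odd_edges m p < 8 * m" "odd_edges m (odd_edges m p) = p"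
    "odd_edges m (quarter m p) = quarter m (odd_edges m p)"
proof -
  consider "p = 0" | "p = 8 * m - 1" | "odd p" "p \<noteq> 8 * m - 1" | "even p" "p \<noteq> 0"
    by blast
  then have "odd_edges m p < 8 * m \<and> odd_edges m (odd_edges m p) = p \<and>
    odd_edges m (quarter m p) = quarter m (odd_edges m p)"
  proof cases
    case 1
    have "odd_edges m (2 * m) = 2 * m - 1"
      using m by (intro odd_edges_simps) auto
    with 1 show ?thesis
      using m odd_edges_simps(1) odd_edges_simps(2)[simplified] by (simp add: quarter_def)
  next
    case 2
    have "odd_edges m (2 * m - 1) = 2 * m - 1 + 1"
      using m by (intro odd_edges_simps) (presburger, linarith)
    moreover have "quarter m p = 2 * m - 1"
      using 2 m by (simp add: quarter_def)
    moreover have "odd_edges m p = 0"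
      unfolding 2 by (rule odd_edges_simps)
    ultimately show ?thesis
      using 2 m by (simp add: odd_edges_simps quarter_def)
  next
    case 3
    have 1: "odd_edges m p = p + 1"
      using 3 by (intro odd_edges_simps)
    have 2: "odd_edges m (p + 1) = p + 1 - 1"
      using 3 by (intro odd_edges_simps) auto
    have "odd_edges m (quarter m p) = quarter m (p + 1)"
    proof (cases "p < 6 * m")
      case True
      then have q: "quarter m p = p + 2 * m" by (simp add: quarter_def)
      show ?thesis
      proof (cases "p = 6 * m - 1")
        case True
        then have "p + 2 * m = 8 * m - 1" "p + 1 = 6 * m" using m by auto
        then show ?thesis unfolding q by (simp add: odd_edges_simps(2) quarter_def del: One_nat_def)
      next
        case False
        have "odd_edges m (p + 2 * m) = p + 2 * m + 1"
          using 3 True False by (intro odd_edges_simps) auto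
        with False True q show ?thesis by (simp add: quarter_def)
      qed
    next
      case False
      have "odd_edges m (p - 6 * m) = p - 6 * m + 1"
        using 3 False assms m by (intro odd_edges_simps) (presburger, linarith)
      with False show ?thesis by (simp add: quarter_def)
    qed
    moreover have "p + 1 < 8 * m" using 3 assms by linarith
    ultimately show ?thesis
      unfolding 1 2 by simp
  next
    case 4
    have 1: "odd_edges m p = p - 1"
      using 4 by (intro odd_edges_simps)
    have "odd_edges m (p - 1) = p - 1 + 1"
      using 4 assms by (intro odd_edges_simps) auto
    then have 2: "odd_edges m (p - 1) = p"
      using 4 by simp
    have "odd_edges m (quarter m p) = quarter m (p - 1)"
    proof (cases "p < 6 * m")
      case True
      have "odd_edges m (p + 2 * m) = p + 2 * m - 1"
        using 4 by (intro odd_edges_simps) auto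
      with True 4 show ?thesis by (simp add: quarter_def)
    next
      case False
      show ?thesis
      proof (cases "p = 6 * m")
        case True
        then show ?thesis using m by (simp add: quarter_def odd_edges_simps)
      next
        case False': False
        have "odd_edges m (p - 6 * m) = p - 6 * m - 1"
          using 4 False False' by (intro odd_edges_simps) (presburger, linarith)
        with False False' show ?thesis by (simp add: quarter_def)
      qed
    qed
    then show ?thesis
      unfolding 1 2 using assms by simp
  qed
  then show "odd_edges m p < 8 * m" "odd_edges m (odd_edges m p) = p"
    "odd_edges m (quarter m p) = quarter m (odd_edges m p)"
    by auto
qed

lemma sign_cases: "sign m p = p \<or> sign m p = half m p"
  by (auto simp: sign_def)

lemma quarter_half: "p < 8 * m \<Longrightarrow> quarter m (half m p) = half m (quarter m p)"
  by (metis quarter_less quarter_quarter)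

lemma sign:
  assumes "p < 8 * m"
  shows "sign m p < 8 * m" "sign m (sign m p) = p" "sign m (quarter m p) = quarter m (sign m p)"
proof -
  let ?S = "{0, 2 * m, 4 * m, 6 * m}"
  have q: "quarter m r \<in> ?S" if "r \<in> ?S" for r
    using that m by (elim insertE emptyE) (simp_all add: quarter_def)
  have iff: "quarter m p \<in> ?S \<longleftrightarrow> p \<in> ?S"
    using q[of p] q[of "quarter m p"] q[of "quarter m (quarter m p)"] q[of "half m (quarter m p)"]
      assms
    by (metis half_half quarter_half quarter_less quarter_quarter)
  have "half m p \<in> ?S \<longleftrightarrow> p \<in> ?S"
    using q[of "quarter m p"] q[of "quarter m (half m p)"] iff assms
    by (metis half_half half_less quarter_half quarter_less quarter_quarter q)
  then show "sign m (sign m p) = p"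
    using assms by (simp only: sign_def half_half if_True if_False split: if_split) blast
  show "sign m (quarter m p) = quarter m (sign m p)"
    using iff quarter_half[OF assms] by (simp only: sign_def if_True if_False split: if_split) blast
  show "sign m p < 8 * m"
    using assms half_less by (auto simp: sign_def)
qed

lemma block:
  assumes "p < 8 * m"
  shows "block m j p < 8 * m" "block m j (block m j p) = p"
    "block m j (quarter m p) = quarter m (block m j p)"
  using assms even_edges odd_edges sign by (auto simp: block_def)

lemma block_half: "p < 8 * m \<Longrightarrow> block m j (half m p) = half m (block m j p)"
  by (metis block(1,3) quarter_less quarter_quarter)

lemma gen_gen: "gen m i (gen m i y) = y"
proof (cases y)
  case (Pair j p)
  then show ?thesis
    by (cases "(j, p) \<in> points m") (auto simp: points_def block even_edges odd_edges sign dest!: less_6_cases)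
qed

lemma gen_permutes: "gen m i permutes points m"
  unfolding permutes_def
  by (metis gen_gen gen.simps surj_pair)

lemma gen_0_2: "gen m 0 (gen m 2 y) = gen m 2 (gen m 0 y)"
  by (cases y) (auto simp: points_def block_def even_edges odd_edges sign dest!: less_6_cases)

lemma words_permutes: "f \<in> words m \<Longrightarrow> f permutes points m"
  by (induction rule: words.induct) (blast intro: permutes_id gen_permutes permutes_compose)+

lemma words_quarter: "f \<in> words m \<Longrightarrow> y \<in> points m \<Longrightarrow>
    f (apsnd (quarter m) y) = apsnd (quarter m) (f y)"
proof (induction arbitrary: y rule: words.induct)
  case (gen i)
  then show ?case
    by (cases y) (auto simp: points_def block quarter_less)
next
  case (comp f g)
  then have "g y \<in> points m"
    using permutes_in_image[OF words_permutes] by blast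
  with comp show ?case by simp
qed auto

lemma words_blocks: "f \<in> words m \<Longrightarrow> p < 8 * m \<Longrightarrow> fst (f (j, p)) = fst (f (j, 0))"
proof (induction arbitrary: j p rule: words.induct)
  case (gen i)
  then show ?case by (auto simp: points_def)
next
  case (comp f g)
  have "snd (g (j, r)) < 8 * m" if "r < 8 * m" for r
    using permutes_in_image[OF words_permutes[OF comp.hyps(2)], of "(j, r)"]
      permutes_not_in[OF words_permutes[OF comp.hyps(2)], of "(j, r)"] that
    by (cases "(j, r) \<in> points m") (auto simp: points_def mem_Times_iff)
  from this[of p] this[of 0] show ?case
    using comp.IH comp.prems by (metis comp_apply gr0I not_less_zero prod.collapse)
qed auto

text \<open>
  Conjugates of \<open>gen m 0\<close> act in copy \<open>0\<close> by the two matchings, which reach every point of the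
  cycle; the rotation \<open>gen m 1 \<circ> gen m 2\<close> then reaches the other copies.
\<close>

lemma words_transitive:
  assumes "y \<in> points m"
  obtains f where "f \<in> words m" "f (0, 0) = y"
proof -
  let ?R = "\<lambda>y. \<exists>f\<in>words m. f (0, 0) = y"
  have step: "?R (f y)" if "?R y" "f \<in> words m" for f y
    using that words.comp by (metis comp_apply)
  have gen_step: "?R (gen m i y)" if "?R y" "i < 3" for i y
    using step[OF that(1) words.gen[OF that(2)]] .
  obtain j p where y: "y = (j, p)" "j < 6" "p < 8 * m"
    using assms by (auto simp: points_def)
  have row: "p < 8 * m \<Longrightarrow> ?R (0, p)" for p
  proof (induction p)
    case 0
    show ?case using words.id by (intro bexI[of _ id]) simp_all
  next
    case (Suc p)
    then have p: "?R (0, p)" "p < 8 * m" "Suc p < 8 * m" by auto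
    show ?case
    proof (cases "even p")
      case True
      have "?R (gen m 1 (gen m 0 (gen m 1 (0, p))))"
        using p by (intro gen_step) auto
      then show ?thesis
        using p True by (simp add: points_def block_def even_edges_def)
    next
      case False
      have "?R (gen m 1 (gen m 2 (gen m 1 (gen m 2 (gen m 1
        (gen m 0 (gen m 1 (gen m 2 (gen m 1 (gen m 2 (gen m 1 (0, p))))))))))))"
        using p by (intro gen_step) auto
      moreover have "p \<noteq> 0" "odd_edges m p = Suc p"
        using p False by (auto simp: odd_edges_def intro: Nat.gr0I)
      ultimately show ?thesis
        using p by (simp add: points_def block_def)
    qed
  qed
  have "j < 6 \<Longrightarrow> ?R (j, p)" for j
  proof (induction j)
    case 0
    show ?case using row y by simp
  next
    case (Suc j)
    then have "?R (gen m 1 (gen m 2 (j, p)))"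
      by (intro gen_step) auto
    moreover have "gen m 1 (gen m 2 (j, p)) = (Suc j, p)"
      using less_6_cases[OF Suc_lessD[OF Suc.prems]] Suc.prems y(3)
      by (elim disjE) (simp_all add: points_def)
    ultimately show ?case by simp
  qed
  then show ?thesis using y that by blast
qed

text \<open>
  The commutator of \<open>gen m 0\<close> with a conjugate by an element of the dihedral group acts in each
  copy as the commutator of two terms of the sequence \<open>block m\<close>.  By the choice of distances in \<open>block\<close>, only
  commutators of \<open>sign m\<close> with one of the two matchings survive, and these are diagonal: if \<open>c\<close>
  negates \<open>x\<^sub>0\<close>, then \<open>a c a\<close> negates the neighbour of \<open>x\<^sub>0\<close> in the matching \<open>a\<close>.  Below,
  \<open>w1\<close> is supported on the copies \<open>0, 1\<close> and \<open>w2\<close> on the copies \<open>0, 5\<close>; both negate \<open>x\<^sub>0\<close> and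
  \<open>x\<^sub>1\<close> in copy \<open>0\<close>.  The element \<open>w3\<close> negates instead \<open>x\<^sub>0\<close> and the last basis vector there.
  Together they separate the line of \<open>x\<^sub>0\<close> in copy \<open>0\<close> from all other basis lines.
\<close>

lemma words_separating:
  assumes z: "z \<in> points m" "z \<notin> {(0, 0), (0, 2 * m), (0, 4 * m), (0, 6 * m)}"
  obtains d where "d \<in> words m" "\<And>y. y \<in> points m \<Longrightarrow> d y = y \<or> d y = apsnd (half m) y"
    "d (0, 0) = (0, 4 * m)" "d z = z"
proof -
  define x1 where "x1 = gen m 1 \<circ> gen m 0 \<circ> gen m 1"
  \<comment> \<open>The reflection \<open>j \<mapsto> 3 - j\<close> of the hexagon exchanges the copies \<open>0\<close> and \<open>3\<close>.\<close>
  define r where "r = gen m 1 \<circ> gen m 2 \<circ> gen m 1 \<circ> gen m 2 \<circ> gen m 1"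
  define x3 where "x3 = r \<circ> gen m 0 \<circ> r"
  define w1 where "w1 = gen m 0 \<circ> x1 \<circ> gen m 0 \<circ> x1"
  define w2 where "w2 = gen m 2 \<circ> w1 \<circ> gen m 2"
  define w3 where "w3 = gen m 0 \<circ> x3 \<circ> gen m 0 \<circ> x3"
  have gens: "gen m 0 \<in> words m" "gen m 1 \<in> words m" "gen m 2 \<in> words m"
    by (auto intro: words.gen)
  have words: "w1 \<in> words m" "w2 \<in> words m" "w3 \<in> words m"
    unfolding w1_def w2_def w3_def x1_def x3_def r_def by (intro words.comp gens)+
  let ?a = even_edges and ?b = "odd_edges m" and ?c = "sign m"
  have w1: "w1 (j, p) = (j, if j = 0 then ?c (?a (?c (?a p))) else if j = 1 then ?a (?c (?a (?c p))) else p)"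
    if "j < 6" "p < 8 * m" for j p
    using less_6_cases[OF that(1)] that(2)
    by (elim disjE) (simp_all add: w1_def x1_def points_def block_def even_edges odd_edges sign)
  have w2: "w2 (j, p) = (j, if j = 0 then ?c (?a (?c (?a p))) else if j = 5 then ?a (?c (?a (?c p))) else p)"
    if "j < 6" "p < 8 * m" for j p
    using less_6_cases[OF that(1)] that(2)
    by (elim disjE) (simp_all add: w2_def w1 points_def even_edges sign)
  have w3: "w3 (j, p) = (j, if j = 0 then ?c (?b (?c (?b p))) else if j = 3 then ?b (?c (?b (?c p))) else p)"
    if "j < 6" "p < 8 * m" for j p
    using less_6_cases[OF that(1)] that(2)
    by (elim disjE) (simp_all add: w3_def x3_def r_def points_def block_def even_edges odd_edges sign)
  have half_ab: "?a (half m p) = half m (?a p)" "?b (half m p) = half m (?b p)" "?c (half m p) = half m (?c p)"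
    if "p < 8 * m" for p
    using block_half[OF that, of 1] block_half[OF that, of 3] block_half[OF that, of 0]
    by (simp_all add: block_def)
  have signs: "?c (?a (?c (?a p))) \<in> {p, half m p}" "?a (?c (?a (?c p))) \<in> {p, half m p}"
    "?c (?b (?c (?b p))) \<in> {p, half m p}" "?b (?c (?b (?c p))) \<in> {p, half m p}"
    if p: "p < 8 * m" for p
    using sign_cases[of "?a p"] sign_cases[of "?b p"] sign_cases[of p] p
    by (auto simp: half_ab half_half half_less even_edges odd_edges sign_cases)
      (metis even_edges half_ab half_half odd_edges sign_cases)+
  have start: "?c (?a (?c (?a 0))) = 4 * m" "?c (?b (?c (?b 0))) = 4 * m"
    using m by (auto simp: sign_def even_edges_def odd_edges_def half_def)
  note result = that
  have sep: thesis if d: "d \<in> words m" "d (0, 0) = (0, 4 * m)" "d z = z"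
      and signs: "\<And>j p. j < 6 \<Longrightarrow> p < 8 * m \<Longrightarrow> d (j, p) = (j, p) \<or> d (j, p) = (j, half m p)" for d
  proof (rule result[OF d(1) _ d(2,3)])
    fix y assume "y \<in> points m"
    then show "d y = y \<or> d y = apsnd (half m) y"
      using signs by (cases y) (auto simp: points_def)
  qed
  obtain j p where jp: "z = (j, p)" "j < 6" "p < 8 * m"
    using z by (auto simp: points_def)
  consider "j \<noteq> 0" "j \<noteq> 1" | "j = 1" | "j = 0" "p \<in> {1, 2 * m + 1, 4 * m + 1, 6 * m + 1}"
    | "j = 0" "p \<notin> {1, 2 * m + 1, 4 * m + 1, 6 * m + 1}"
    by blast
  then show thesis
  proof cases
    case 1
    show ?thesis
      by (rule sep[OF words(1)]) (use 1 jp m start signs in \<open>auto simp: w1\<close>)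
  next
    case 2
    show ?thesis
      by (rule sep[OF words(2)]) (use 2 jp m start signs in \<open>auto simp: w2\<close>)
  next
    case 3
    have "odd p" "p \<noteq> 8 * m - 1" "p \<noteq> 0"
      using 3 m by auto
    then have "?b p = p + 1" by (simp add: odd_edges_def)
    moreover have "?c (p + 1) = p + 1" "?c p = p"
      using 3 m by (auto simp: sign_def)
    ultimately have "?c (?b (?c (?b p))) = p"
      using odd_edges(2)[OF jp(3)] by simp
    then show ?thesis
      by (intro sep[OF words(3)]) (use 3 jp m start signs in \<open>auto simp: w3\<close>)
  next
    case 4
    have "?c p = p"
      using 4 jp z by (auto simp: sign_def)
    moreover have "?a p \<notin> {0, 2 * m, 4 * m, 6 * m}"
    proof
      assume "?a p \<in> {0, 2 * m, 4 * m, 6 * m}"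
      then have "?a (?a p) \<in> {1, 2 * m + 1, 4 * m + 1, 6 * m + 1}"
        by (auto simp: even_edges_def[of "0"] even_edges_def[of "2 * m"] even_edges_def[of "4 * m"] even_edges_def[of "6 * m"])
      with 4 even_edges(2)[OF jp(3)] show False by simp
    qed
    then have "?c (?a p) = ?a p" by (simp add: sign_def)
    ultimately have "?c (?a (?c (?a p))) = p"
      using even_edges(2)[OF jp(3)] by simp
    then show ?thesis
      by (intro sep[OF words(1)]) (use 4 jp m start signs in \<open>auto simp: w1\<close>)
  qed
qed

end

section \<open>The polytopes and their realizations\<close>

theorem theorem4p5:
  fixes N :: nat
  shows "\<exists>(G :: nat monoid) (n :: nat) (s :: nat \<Rightarrow> nat) (H :: nat set) (\<Omega> :: nat set set)
      (S :: (nat \<Rightarrow>\<^sub>0 real) set) (act :: (nat \<Rightarrow>\<^sub>0 real) \<Rightarrow> nat \<Rightarrow> (nat \<Rightarrow>\<^sub>0 real))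
      (A :: nat set \<Rightarrow> (nat \<Rightarrow>\<^sub>0 real)).
    string_C_group G n s \<and> finite (carrier G) \<and>
    H = vertex_stabilizer G n s \<and>
    \<Omega> = rcosets\<^bsub>G\<^esub> H \<and>
    pure_realization G \<Omega> (\<lambda>\<omega> g. \<omega> #>\<^bsub>G\<^esub> g) S act A \<and>
    simple_RG_module G S act \<and>
    S = real_vector.span (A ` \<Omega>) \<and>
    complex_type G S act \<and>
    essential_wythoff_dim G H S act \<ge> N"
proof -
  \<comment> \<open>The Wythoff space will have dimension \<open>2 m\<close> over the complex numbers. The condition \<open>m \<ge> 2\<close> ensures that the two neighbours of \<open>x\<^sub>0\<close> on the cycle lie on different lines.\<close>
  define m where "m = N + 2"
  then have m: "m \<ge> 2" by simp
  have "finite (points m)"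
    by (simp add: points_def)
  then obtain P :: "nat monoid" and dec where P: "group P" "finite (carrier P)"
    "bij_betw dec (carrier P) {f. f permutes points m}" "dec \<one>\<^bsub>P\<^esub> = id"
    "\<And>x y. x \<in> carrier P \<Longrightarrow> y \<in> carrier P \<Longrightarrow> dec (x \<otimes>\<^bsub>P\<^esub> y) = dec x \<circ> dec y"
    using finite_permutation_group_nat_copy by blast
  interpret P: group P by (rule P(1))
  have dec_inj: "x = y" if "dec x = dec y" "x \<in> carrier P" "y \<in> carrier P" for x y
    using P(3) that by (auto simp: bij_betw_def dest: inj_onD)
  define s where "s i = inv_into (carrier P) dec (gen m i)" for i
  have s: "s i \<in> carrier P" "dec (s i) = gen m i" for i
  proof -
    have "gen m i \<in> dec ` carrier P"
      using P(3) gen_permutes[OF m] by (auto simp: bij_betw_def)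
    then show "s i \<in> carrier P" "dec (s i) = gen m i"
      unfolding s_def by (auto intro: inv_into_into f_inv_into_f)
  qed
  have s_square: "s i \<otimes>\<^bsub>P\<^esub> s i = \<one>\<^bsub>P\<^esub>" for i
    using gen_gen[OF m] by (intro dec_inj) (auto simp: P s)
  define K where "K = generate P (s ` {..<3})"
  define G where "G = P\<lparr>carrier := K\<rparr>"
  have sP: "s ` I \<subseteq> carrier P" for I
    using s by auto
  have K: "subgroup K P"
    unfolding K_def using sP by (rule P.generate_is_subgroup)
  have KP: "g \<in> carrier P" if "g \<in> K" for g
    using K that by (rule subgroup.mem_carrier)
  interpret G: group G
    unfolding G_def using K by (rule P.subgroup_imp_group)
  have G: "carrier G = K" "mult G = mult P" "\<one>\<^bsub>G\<^esub> = \<one>\<^bsub>P\<^esub>"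
    by (simp_all add: G_def)
  have generate_G: "generate G (s ` I) = generate P (s ` I)" if "I \<subseteq> {..<3}" for I
    unfolding G_def using that K
    by (intro P.generate_consistent) (auto simp: K_def intro: generate.incl)
  have words: "dec g \<in> words m" if "g \<in> K" for g
    using that unfolding K_def
  proof (induction rule: P.generate_involutions_induct)
    case (mult g t)
    then obtain i where i: "i < 3" "t = s i" by auto
    have "g \<in> carrier P"
      using mult(1) KP K_def by blast
    then have "dec (g \<otimes>\<^bsub>P\<^esub> t) = dec g \<circ> gen m i"
      using i by (simp add: P s)
    with words.comp[OF mult.IH words.gen[OF i(1)]] i show ?case
      by (simp only:)
  next
    case one
    show ?case
      unfolding P(4) by (rule words.id)
  qed (use sP s_square in auto)
  have words_K: "\<exists>g\<in>K. dec g = f" if "f \<in> words m" for f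
    using that
  proof (induction rule: words.induct)
    case id
    show ?case using P(4) K subgroup.one_closed by blast
  next
    case (gen i)
    then have "s i \<in> K"
      unfolding K_def by (intro generate.incl) auto
    then show ?case using s by blast
  next
    case (comp f g)
    then obtain x y where xy: "x \<in> K" "y \<in> K" "dec x = f" "dec y = g" by auto
    then have "x \<otimes>\<^bsub>P\<^esub> y \<in> K" "dec (x \<otimes>\<^bsub>P\<^esub> y) = f \<circ> g"
      using K KP by (auto simp: P subgroup.m_closed)
    then show ?case by blast
  qed
  have dec_mult: "dec (g \<otimes>\<^bsub>G\<^esub> h) = dec g \<circ> dec h" if "g \<in> K" "h \<in> K" for g h
    using that KP by (simp add: G P)

  define H where "H = vertex_stabilizer G 3 s"
  have "{1..<3} = {1, 2::nat}" by auto
  then have H_eq: "H = generate P (s ` {1, 2})" "H = generate G (s ` {1, 2})"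
    using generate_G[of "{1, 2}"] by (auto simp: H_def vertex_stabilizer_def)
  have H_K: "H \<subseteq> K"
    unfolding H_eq(1) K_def by (intro P.mono_generate) auto
  have H_sub: "subgroup H G"
    unfolding H_eq(2) by (intro G.generate_is_subgroup) (auto simp: G K_def intro: generate.incl)
  \<comment> \<open>The vertex stabilizer moves the copies and never the position in the cycle.\<close>
  have H_act: "dec h (j, p) = (fst (dec h (j, 0)), p)" if "h \<in> H" "p < 8 * m" for h j p
    using that(1) unfolding H_eq(1)
  proof (induction arbitrary: j rule: P.generate_involutions_induct)
    case (mult g t)
    then obtain i where i: "i \<in> {1, 2}" "t = s i" by auto
    have "g \<in> carrier P"
      using mult(1) sP P.generate_in_carrier by blast
    then have dec: "dec (g \<otimes>\<^bsub>P\<^esub> t) y = dec g (gen m i y)" for y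
      using i by (simp add: P s)
    have "gen m i (j, p) = (fst (gen m i (j, 0)), p)" "gen m i (j, 0) = (fst (gen m i (j, 0)), 0)"
      using i that(2) by (auto simp: points_def)
    then show ?case
      unfolding dec using mult.IH by metis
  qed (use sP s_square P in auto)

  \<comment> \<open>The induced permutation of the six copies forgets \<open>s 0\<close> and determines each element of \<open>H\<close>.\<close>
  have C_group: "string_C_group G 3 s"
  proof (rule G.string_C_group_rank3I[where \<rho> = "\<lambda>g j. fst (dec g (j, 0))" and comb = "(\<circ>)"])
    let ?\<rho> = "\<lambda>g j. fst (dec g (j, 0))"
    show "s i \<in> carrier G" if "i < 3" for i
      using that by (auto simp: G K_def intro: generate.incl)
    have pts: "(0, 0) \<in> points m" "(1, 0) \<in> points m"
      using m by (auto simp: points_def)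
    have gens: "gen m 0 (0, 0) = (0, 4 * m)" "gen m 1 (0, 0) = (1, 0)" "gen m 2 (0, 0) = (0, 0)"
      "gen m 2 (1, 0) = (5, 0)"
      using pts m by (simp_all add: block_def sign_def half_def)
    show "s i \<noteq> \<one>\<^bsub>G\<^esub>" if "i < 3" for i
    proof
      assume "s i = \<one>\<^bsub>G\<^esub>"
      then have "gen m i = id"
        using s(2)[of i] P(4) by (simp add: G)
      then have "gen m i z = z" for z
        by simp
      from this[of "(0, 0)"] this[of "(1, 0)"] show False
        using less_3_cases[OF that] gens m by (elim disjE) (simp_all del: gen.simps)
    qed
    show "s i \<otimes>\<^bsub>G\<^esub> s i = \<one>\<^bsub>G\<^esub>" if "i < 3" for i
      by (simp add: G s_square)
    show "generate G (s ` {..<3}) = carrier G"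
      by (simp add: generate_G G K_def)
    have "s 0 \<otimes>\<^bsub>P\<^esub> s 2 = s 2 \<otimes>\<^bsub>P\<^esub> s 0"
      using gen_0_2[OF m] by (intro dec_inj) (auto simp: P s)
    then show "s 0 \<otimes>\<^bsub>G\<^esub> s 2 = s 2 \<otimes>\<^bsub>G\<^esub> s 0"
      by (simp add: G)
    show "s 1 \<noteq> s 2"
      using s(2)[of 1] s(2)[of 2] gens by (auto simp del: gen.simps)
    show "?\<rho> (x \<otimes>\<^bsub>G\<^esub> y) = ?\<rho> x \<circ> ?\<rho> y" if "x \<in> carrier G" "y \<in> carrier G" for x y
    proof
      fix j
      obtain k p where kp: "dec y (j, 0) = (k, p)" by fastforce
      have "dec y permutes points m"
        using that words words_permutes[OF m] by (simp add: G)
      then have "p < 8 * m"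
        using kp m permutes_in_image[of "dec y" "points m" "(j, 0)"]
          permutes_not_in[of "dec y" "points m" "(j, 0)"]
        by (cases "(j, 0) \<in> points m") (auto simp: points_def)
      with that(1) have "fst (dec x (k, p)) = fst (dec x (k, 0))"
        by (intro words_blocks[OF m words]) (simp_all add: G)
      with that kp show "?\<rho> (x \<otimes>\<^bsub>G\<^esub> y) j = (?\<rho> x \<circ> ?\<rho> y) j"
        by (simp add: dec_mult G(1))
    qed
    show "?\<rho> (s 0) = ?\<rho> \<one>\<^bsub>G\<^esub>"
      by (auto simp: s P G)
    show "inj_on ?\<rho> (generate G (s ` {1, 2}))"
    proof (rule inj_onI, rule dec_inj)
      fix x y assume xy: "x \<in> generate G (s ` {1, 2})" "y \<in> generate G (s ` {1, 2})" "?\<rho> x = ?\<rho> y"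
      then have H: "x \<in> H" "y \<in> H" by (simp_all add: H_eq(2))
      then show "x \<in> carrier P" "y \<in> carrier P"
        using H_K KP by auto
      have perm: "dec x permutes points m" "dec y permutes points m"
        using H H_K words words_permutes[OF m] by auto
      show "dec x = dec y"
      proof
        fix z
        show "dec x z = dec y z"
        proof (cases "z \<in> points m")
          case True
          then obtain j p where z: "z = (j, p)" "p < 8 * m"
            by (auto simp: points_def)
          then show ?thesis
            using H_act[OF H(1) z(2)] H_act[OF H(2) z(2)] fun_cong[OF xy(3)] by simp
        qed (use perm in \<open>simp add: permutes_not_in\<close>)
      qed
    qed
  qed

  \<comment> \<open>The points are coded as natural numbers, to obtain the required type of vectors.\<close>
  define Y where "Y = prod_encode ` points m"
  define \<pi> where "\<pi> g = prod_encode \<circ> dec g \<circ> prod_decode" for g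
  define J where "J = prod_encode \<circ> apsnd (quarter m) \<circ> prod_decode"
  have Y: "prod_encode z \<in> Y \<longleftrightarrow> z \<in> points m" for z
    by (auto simp: Y_def prod_encode_eq)
  have Y_cases: thesis if "y \<in> Y" "\<And>z. y = prod_encode z \<Longrightarrow> z \<in> points m \<Longrightarrow> thesis" for y thesis
    using that by (auto simp: Y_def)
  have \<pi>: "\<pi> g (prod_encode z) = prod_encode (dec g z)" for g z
    by (simp add: \<pi>_def)
  have J: "J (prod_encode z) = prod_encode (apsnd (quarter m) z)" for z
    by (simp add: J_def)
  have pts_quarter: "apsnd (quarter m) z \<in> points m" if "z \<in> points m" for z
    using that quarter_less[OF m] by (auto simp: points_def)
  have JJ: "J (J (prod_encode z)) = prod_encode (apsnd (half m) z)" if "z \<in> points m" for z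
    using that by (cases z) (auto simp: J points_def quarter_quarter[OF m])
  have half_pts: "apsnd (half m) z \<in> points m" if "z \<in> points m" for z
    using that half_less[OF m] by (auto simp: points_def)
  interpret signed_permutation_action G Y \<pi> J "prod_encode (0, 0)"
  proof
    show "finite Y" by (simp add: Y_def points_def)
    show "\<pi> g y \<in> Y" if "g \<in> carrier G" "y \<in> Y" for g y
      using that(2) permutes_in_image[OF words_permutes[OF m words]] that(1)
      by (elim Y_cases) (simp add: \<pi> Y G)
    show "\<pi> \<one>\<^bsub>G\<^esub> y = y" if "y \<in> Y" for y
      using that by (simp add: \<pi>_def G P)
    show "\<pi> (g \<otimes>\<^bsub>G\<^esub> h) y = \<pi> g (\<pi> h y)" if "g \<in> carrier G" "h \<in> carrier G" "y \<in> Y" for g h y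
      using that by (simp add: \<pi>_def dec_mult G(1))
    show "J y \<in> Y" if "y \<in> Y" for y
      using that by (elim Y_cases) (simp add: J Y pts_quarter)
    show "J (J (J (J y))) = y" if "y \<in> Y" for y
      using that
    proof (elim Y_cases)
      fix z assume z: "y = prod_encode z" "z \<in> points m"
      then have "apsnd (half m) (apsnd (half m) z) = z"
        using half_half[OF m] by (auto simp: points_def)
      with z show ?thesis by (simp add: JJ half_pts)
    qed
    show "J (J y) \<noteq> y" if "y \<in> Y" for y
      using that
    proof (elim Y_cases)
      fix z assume z: "y = prod_encode z" "z \<in> points m"
      have "apsnd (half m) z \<noteq> z"
        using half_neq[OF m] by (cases z) auto
      with z show ?thesis by (simp add: JJ prod_encode_eq)
    qed
    show "\<pi> g (J y) = J (\<pi> g y)" if "g \<in> carrier G" "y \<in> Y" for g y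
      using that(2) words_quarter[OF m words] that(1)
      by (elim Y_cases) (simp add: \<pi> J G)
    show "prod_encode (0, 0) \<in> Y"
      using m by (simp add: Y points_def)
    show "\<exists>g\<in>carrier G. \<pi> g (prod_encode (0, 0)) = y" if "y \<in> Y" for y
      using that
    proof (elim Y_cases)
      fix z assume z: "y = prod_encode z" "z \<in> points m"
      obtain f where "f \<in> words m" "f (0, 0) = z"
        using words_transitive[OF m z(2)] .
      then show ?thesis
        using words_K z by (force simp: G \<pi>)
    qed
    show "\<exists>d\<in>carrier G. (\<forall>y\<in>Y. \<pi> d y = y \<or> \<pi> d y = J (J y)) \<and>
        \<pi> d (prod_encode (0, 0)) = J (J (prod_encode (0, 0))) \<and> \<pi> d y = y"
      if y: "y \<in> Y" "y \<notin> {prod_encode (0, 0), J (prod_encode (0, 0)), J (J (prod_encode (0, 0))),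
          J (J (J (prod_encode (0, 0))))}" for y
      using y(1)
    proof (elim Y_cases)
      fix z assume z: "y = prod_encode z" "z \<in> points m"
      have "z \<notin> {(0, 0), (0, 2 * m), (0, 4 * m), (0, 6 * m)}"
        using y(2) m z by (auto simp: J quarter_def prod_encode_eq)
      then obtain f where f: "f \<in> words m" "\<And>y. y \<in> points m \<Longrightarrow> f y = y \<or> f y = apsnd (half m) y"
        "f (0, 0) = (0, 4 * m)" "f z = z"
        using words_separating[OF m z(2)] by blast
      then obtain d where d: "d \<in> K" "dec d = f"
        using words_K by blast
      have "\<pi> d y = y \<or> \<pi> d y = J (J y)" if "y \<in> Y" for y
        using that f(2) d(2) by (elim Y_cases) (auto simp: \<pi> JJ)
      moreover have "\<pi> d (prod_encode (0, 0)) = J (J (prod_encode (0, 0)))"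
        using f(3) d(2) m by (simp add: \<pi> J quarter_def)
      moreover have "\<pi> d y = y"
        using f(4) d(2) z by (simp add: \<pi>)
      ultimately show ?thesis
        using d(1) by (auto simp: G)
    qed
  qed

  \<comment> \<open>\<open>W q\<close> is the sum over the six copies of the basis vector with the position of \<open>q\<close>; it does not depend on the copy and is therefore fixed by \<open>H\<close>.\<close>
  define W where "W q = vec (\<lambda>y. let r = snd (prod_decode y); p = snd (prod_decode q) in
    (if r = p then 1 else 0) - (if r = p + 4 * m then 1 else 0))" for q
  define Q where "Q = (\<lambda>p. prod_encode (0, p)) ` {..<2 * m}"
  have W_Y: "Poly_Mapping.lookup (W (prod_encode (0, p))) (prod_encode (j, r)) =
      (if r = p then 1 else 0) - (if r = p + 4 * m then 1 else 0)" if "(j, r) \<in> points m" for j p r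
    using that by (simp add: W_def Y Let_def)
  have W_V: "W (prod_encode (0, p)) \<in> V" if "p < 2 * m" for p
    unfolding V_iff
  proof (intro conjI ballI)
    fix y assume "y \<in> Y"
    then show "Poly_Mapping.lookup (W (prod_encode (0, p))) (J (J y)) =
      - Poly_Mapping.lookup (W (prod_encode (0, p))) y"
    proof (elim Y_cases)
      fix z assume z: "y = prod_encode z" "z \<in> points m"
      obtain j r where jr: "z = (j, r)" by fastforce
      have "half m r = p \<longleftrightarrow> r = p + 4 * m" "half m r = p + 4 * m \<longleftrightarrow> r = p"
        using that z jr by (auto simp: half_def points_def)
      moreover have "(j, half m r) \<in> points m"
        using half_pts[OF z(2)] jr by simp
      ultimately show ?thesis
        using z jr by (simp add: JJ W_Y)
    qed
  qed (simp add: W_def)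
  have W_Fix: "W q \<in> Fix act V H" if "q \<in> Q" for q
  proof -
    obtain p where p: "q = prod_encode (0, p)" "p < 2 * m"
      using \<open>q \<in> Q\<close> by (auto simp: Q_def)
    have "act (W q) h = W q" if h: "h \<in> H" for h
    proof (rule vec_eqI)
      have hG: "h \<in> carrier G" using h H_K by (auto simp: G)
      then show "act (W q) h \<in> V"
        using W_V p by (auto intro: act_in_V)
      fix y assume y: "y \<in> Y"
      then show "Poly_Mapping.lookup (act (W q) h) y = Poly_Mapping.lookup (W q) y"
      proof (elim Y_cases)
        fix z assume z: "y = prod_encode z" "z \<in> points m"
        obtain j r where jr: "z = (j, r)" by fastforce
        then have "dec h z = (fst (dec h (j, 0)), r)"
          using H_act[OF h, of r j] z by (simp add: points_def)
        moreover have "dec h z \<in> points m"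
          using permutes_in_image[OF words_permutes[OF m words]] z hG by (simp add: G)
        ultimately show ?thesis
          using y z jr p(1) by (simp add: act_def \<pi> W_Y)
      qed
    qed (use W_V p in auto)
    then show ?thesis
      using W_V p by (simp add: Fix_def)
  qed
  have Q_Y: "Q \<subseteq> Y"
    by (auto simp: Q_def Y points_def)
  have "card Q \<le> essential_wythoff_dim G H V act"
  proof (rule card_le_essential_wythoff_dim)
    show "H \<subseteq> carrier G" using H_K by (simp add: G)
    show "finite Q" by (simp add: Q_def)
    fix q q' assume "q \<in> Q" "q' \<in> Q"
    then obtain p p' where p: "q = prod_encode (0, p)" "q' = prod_encode (0, p')" "p < 2 * m" "p' < 2 * m"
      by (auto simp: Q_def)
    then show "Poly_Mapping.lookup (W q) q' = (if q = q' then 1 else 0)"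
      by (simp add: W_Y points_def prod_encode_eq)
    from p show "Poly_Mapping.lookup (W q) (J q') = 0"
      by (simp add: J W_Y points_def quarter_def)
  qed (use Q_Y W_Fix in auto)
  moreover have "card Q = 2 * m"
    by (simp add: Q_def card_image inj_on_def prod_encode_eq)
  ultimately have dim: "N \<le> essential_wythoff_dim G H V act"
    by (simp add: m_def)

  define w where "w = W (prod_encode (0, 0))"
  have w: "w \<in> Fix act V H"
    using W_Fix m by (auto simp: w_def Q_def)
  have "Poly_Mapping.lookup w (prod_encode (0, 0)) = 1"
    using m by (simp add: w_def W_Y points_def)
  then have "w \<noteq> 0" by auto
  then obtain A where "pure_realization G (rcosets\<^bsub>G\<^esub> H) (\<lambda>\<omega> g. \<omega> #>\<^bsub>G\<^esub> g) V act A"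
    "real_vector.span (A ` (rcosets\<^bsub>G\<^esub> H)) = V"
    using pure_realization_on_cosets[OF simple_V euclidean H_sub w] by blast
  moreover have "finite (carrier G)"
    using KP P(2) by (auto simp: G intro: finite_subset)
  ultimately show ?thesis
    using C_group H_def simple_V complex_type_V dim by blast
qed

end
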